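(* Let $T>0$, let $H:=\bigoplus_{i=0}^\infty\mathbb C^2$ (Hilbert space direct sum) and let $(\lambda_i)_{i\ge0}$ be an unbounded increasing sequence of positive real numbers. Let $A_0:=\bigoplus_{i=0}^\infty a_i$ with $$a_i=\begin{pmatrix}-\lambda_i&0\\0&\lambda_i\end{pmatrix},$$ the unbounded self-adjoint operator in $H$ with domain $\{(x_i)_i\in H:\sum_i\|a_ix_i\|^2<\infty\}$. Then there is a (uniformly) bounded family $B:[0,T]\to B(H)$ such that the family $A(t):=A_0+B(t)$, $t\in[0,T]$, satisfies the following requirements: all $A(t)$ are self-adjoint Fredholm operators in $H$ with the same domain $W$, and $t\mapsto A(t)$ is strongly continuously differentiable in $B(W,H)$; and such that the associated operator $D_{\mathrm{APS}}$ is not Fredholm.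
   Context: $B(H)$ and $B(W,H)$ denote spaces of bounded operators; $W$ carries the graph norm of $A(0)$, $\|x\|_W^2=\|x\|^2+\|A(0)x\|^2$. Strongly continuously differentiable means differentiable with respect to the strong operator topology with strongly continuous derivative. Fredholm: a bounded operator between Hilbert spaces is Fredholm if its kernel and its vector space cokernel are finite dimensional. An unbounded operator $F$ is Fredholm if it is Fredholm as a bounded operator from $\operatorname{Dom}(F)$ with graph norm. For a family $A$ satisfying the listed requirements, $D$ is the closure in $L^2([0,T],H)$ of the (closable) operator with domain $C^1([0,T],W)$ given by $f\mapsto f'-iA(\cdot)f(\cdot)$. Elements of $\operatorname{Dom}(D)$ have continuous representatives $[0,T]\to H$. With $H_{<0}(t):=\operatorname{Ran}\chi_{(-\infty,0)}(A(t))$ and $H_{\ge0}(t):=\operatorname{Ran}\chi_{[0,\infty)}(A(t))$, the operator $D_{\mathrm{APS}}$ is the restriction of $D$ to $\{f\in\operatorname{Dom}(D): f(0)\in H_{<0}(0),\ f(T)\in H_{\ge0}(T)\}$. *)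

theory Defs
  imports "HOL-Analysis.Analysis" "HOL-Library.Function_Algebras"
begin

section \<open>The Hilbert space direct sum of countably many copies of \<open>\<complex>\<^sup>2\<close>\<close>

typedef hsum = "{x :: nat \<Rightarrow> complex ^ 2. summable (\<lambda>i. (norm (x i))\<^sup>2)}"
  morphisms block Abs_hsum
  by (rule exI [of _ "\<lambda>_. 0"]) simp

setup_lifting type_definition_hsum

lemma square_summable_add:
  fixes x y :: "nat \<Rightarrow> 'a :: real_inner"
  assumes "summable (\<lambda>i. (norm (x i))\<^sup>2)" "summable (\<lambda>i. (norm (y i))\<^sup>2)"
  shows "summable (\<lambda>i. (norm (x i + y i))\<^sup>2)"
proof (rule summable_comparison_test)
  have "(norm (x i + y i))\<^sup>2 \<le> 2 * ((norm (x i))\<^sup>2 + (norm (y i))\<^sup>2)" for i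
  proof -
    have "(norm (x i + y i))\<^sup>2 + (norm (x i - y i))\<^sup>2 = 2 * ((norm (x i))\<^sup>2 + (norm (y i))\<^sup>2)"
      by (simp add: power2_norm_eq_inner inner_simps inner_commute)
    moreover have "0 \<le> (norm (x i - y i))\<^sup>2" by simp
    ultimately show ?thesis by linarith
  qed
  then show "\<exists>N. \<forall>n\<ge>N. norm ((norm (x n + y n))\<^sup>2) \<le> 2 * ((norm (x n))\<^sup>2 + (norm (y n))\<^sup>2)"
    by simp
  show "summable (\<lambda>i. 2 * ((norm (x i))\<^sup>2 + (norm (y i))\<^sup>2))"
    by (intro summable_mult summable_add assms)
qed

lemma square_summable_inner:
  fixes x y :: "nat \<Rightarrow> 'a :: real_inner"
  assumes "summable (\<lambda>i. (norm (x i))\<^sup>2)" "summable (\<lambda>i. (norm (y i))\<^sup>2)"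
  shows "summable (\<lambda>i. inner (x i) (y i))"
proof (rule summable_comparison_test)
  have "\<bar>inner (x i) (y i)\<bar> \<le> (norm (x i))\<^sup>2 + (norm (y i))\<^sup>2" for i
  proof -
    have "\<bar>inner (x i) (y i)\<bar> \<le> norm (x i) * norm (y i)"
      by (rule Cauchy_Schwarz_ineq2)
    also have "\<dots> \<le> (norm (x i))\<^sup>2 + (norm (y i))\<^sup>2"
    proof -
      have "0 \<le> norm (x i) * norm (y i)" by simp
      then show ?thesis using sum_squares_bound [of "norm (x i)" "norm (y i)"] by linarith
    qed
    finally show ?thesis .
  qed
  then show "\<exists>N. \<forall>n\<ge>N. norm (inner (x n) (y n)) \<le> (norm (x n))\<^sup>2 + (norm (y n))\<^sup>2"
    by simp
  show "summable (\<lambda>i. (norm (x i))\<^sup>2 + (norm (y i))\<^sup>2)"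
    by (intro summable_add assms)
qed

lemma norm_vector_scalar_mult:
  fixes x :: "complex ^ 'n"
  shows "norm (c *s x) = norm c * norm x"
  by (simp add: norm_vec_def L2_set_right_distrib norm_mult)

instantiation hsum :: real_inner
begin

lift_definition zero_hsum :: hsum is "\<lambda>_. 0"
  by simp

lift_definition plus_hsum :: "hsum \<Rightarrow> hsum \<Rightarrow> hsum" is "\<lambda>x y i. x i + y i"
  by (rule square_summable_add)

lift_definition uminus_hsum :: "hsum \<Rightarrow> hsum" is "\<lambda>x i. - x i"
  by simp

lift_definition minus_hsum :: "hsum \<Rightarrow> hsum \<Rightarrow> hsum" is "\<lambda>x y i. x i - y i"
  subgoal for x y using square_summable_add [of x "\<lambda>i. - y i"] by simp
  done

lift_definition scaleR_hsum :: "real \<Rightarrow> hsum \<Rightarrow> hsum" is "\<lambda>r x i. r *\<^sub>R x i"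
  unfolding norm_scaleR power_mult_distrib by (rule summable_mult)

lift_definition inner_hsum :: "hsum \<Rightarrow> hsum \<Rightarrow> real" is "\<lambda>x y. \<Sum>i. inner (x i) (y i)" .

definition norm_hsum :: "hsum \<Rightarrow> real" where
  "norm_hsum x = sqrt (inner x x)"

definition sgn_hsum :: "hsum \<Rightarrow> hsum" where
  "sgn_hsum x = scaleR (inverse (norm x)) x"

definition dist_hsum :: "hsum \<Rightarrow> hsum \<Rightarrow> real" where
  "dist_hsum x y = norm (x - y)"

definition uniformity_hsum :: "(hsum \<times> hsum) filter" where
  "uniformity_hsum = (INF e\<in>{0<..}. principal {(x, y). dist x y < e})"

definition open_hsum :: "hsum set \<Rightarrow> bool" where
  "open_hsum U = (\<forall>x\<in>U. \<forall>\<^sub>F (x', y) in uniformity. x' = x \<longrightarrow> y \<in> U)"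

instance
proof
  fix x y z :: hsum and r s :: real
  show "x + y + z = x + (y + z)" by transfer (simp add: add.assoc)
  show "x + y = y + x" by transfer (simp add: add.commute)
  show "0 + x = x" by transfer simp
  show "- x + x = 0" by transfer simp
  show "x - y = x + - y" by transfer simp
  show "r *\<^sub>R (x + y) = r *\<^sub>R x + r *\<^sub>R y" by transfer (simp add: scaleR_add_right)
  show "(r + s) *\<^sub>R x = r *\<^sub>R x + s *\<^sub>R x" by transfer (simp add: scaleR_add_left)
  show "r *\<^sub>R s *\<^sub>R x = (r * s) *\<^sub>R x" by transfer simp
  show "1 *\<^sub>R x = x" by transfer simp
  show "sgn x = scaleR (inverse (norm x)) x" by (rule sgn_hsum_def)
  show "dist x y = norm (x - y)" by (rule dist_hsum_def)
  show "uniformity = (INF e\<in>{0<..}. principal {(x :: hsum, y). dist x y < e})"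
    by (rule uniformity_hsum_def)
  show "open U = (\<forall>x\<in>U. \<forall>\<^sub>F (x', y) in uniformity. x' = x \<longrightarrow> y \<in> U)" for U :: "hsum set"
    by (rule open_hsum_def)
  show "inner x y = inner y x" by transfer (simp add: inner_commute)
  show "inner (x + y) z = inner x z + inner y z"
    by transfer (simp add: inner_add_left suminf_add square_summable_inner)
  show "inner (r *\<^sub>R x) y = r * inner x y"
    by transfer (simp add: suminf_mult square_summable_inner)
  show "0 \<le> inner x x"
    by transfer (simp add: suminf_nonneg square_summable_inner)
  show "inner x x = 0 \<longleftrightarrow> x = 0"
    by transfer (auto simp: suminf_eq_zero_iff square_summable_inner fun_eq_iff)
  show "norm x = sqrt (inner x x)" by (rule norm_hsum_def)
qed

end

lift_definition scaleC :: "complex \<Rightarrow> hsum \<Rightarrow> hsum" (infixr "*\<^sub>C" 75) is "\<lambda>c x i. c *s x i"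
  unfolding norm_vector_scalar_mult power_mult_distrib by (rule summable_mult)

definition cinner :: "hsum \<Rightarrow> hsum \<Rightarrow> complex" where
  "cinner x y = (\<Sum>i. \<Sum>j\<in>UNIV. cnj (block x i $ j) * block y i $ j)"


section \<open>Bounded and unbounded operators\<close>

text \<open>An unbounded operator in \<^typ>\<open>hsum\<close> is given by its domain \<open>W\<close> and a function
  \<open>A\<close> of which only the values on \<open>W\<close> matter.\<close>

definition clinear_on :: "hsum set \<Rightarrow> (hsum \<Rightarrow> hsum) \<Rightarrow> bool" where
  "clinear_on W A \<longleftrightarrow>
    0 \<in> W \<and> (\<forall>x\<in>W. \<forall>y\<in>W. x + y \<in> W \<and> A (x + y) = A x + A y) \<and>
    (\<forall>c. \<forall>x\<in>W. c *\<^sub>C x \<in> W \<and> A (c *\<^sub>C x) = c *\<^sub>C A x)"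

definition bounded_op_on :: "hsum set \<Rightarrow> (hsum \<Rightarrow> real) \<Rightarrow> (hsum \<Rightarrow> hsum) \<Rightarrow> bool" where
  "bounded_op_on W N F \<longleftrightarrow> clinear_on W F \<and> (\<exists>K. \<forall>x\<in>W. norm (F x) \<le> K * N x)"

abbreviation bounded_op :: "(hsum \<Rightarrow> hsum) \<Rightarrow> bool" where
  "bounded_op \<equiv> bounded_op_on UNIV norm"

definition graph_norm :: "(hsum \<Rightarrow> hsum) \<Rightarrow> hsum \<Rightarrow> real" where
  "graph_norm A x = sqrt ((norm x)\<^sup>2 + (norm (A x))\<^sup>2)"

definition op_graph :: "hsum set \<Rightarrow> (hsum \<Rightarrow> hsum) \<Rightarrow> (hsum \<times> hsum) set" where
  "op_graph W A = {(x, A x) | x. x \<in> W}"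

definition adjoint_graph :: "hsum set \<Rightarrow> (hsum \<Rightarrow> hsum) \<Rightarrow> (hsum \<times> hsum) set" where
  "adjoint_graph W A = {(y, z). \<forall>x\<in>W. cinner (A x) y = cinner x z}"

definition self_adjoint :: "hsum set \<Rightarrow> (hsum \<Rightarrow> hsum) \<Rightarrow> bool" where
  "self_adjoint W A \<longleftrightarrow>
    clinear_on W A \<and> closure W = UNIV \<and> adjoint_graph W A = op_graph W A"


section \<open>Fredholm operators\<close>

text \<open>The quotient of \<open>V\<close> by its subspace \<open>N\<close> is finite dimensional: finitely many elements of
  \<open>V\<close> span it modulo \<open>N\<close>.\<close>

definition finite_dim_quotient ::
  "(complex \<Rightarrow> 'v \<Rightarrow> 'v) \<Rightarrow> 'v :: ab_group_add set \<Rightarrow> 'v set \<Rightarrow> bool" where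
  "finite_dim_quotient smul V N \<longleftrightarrow>
    (\<exists>S. finite S \<and> S \<subseteq> V \<and> (\<forall>v\<in>V. \<exists>c. v - (\<Sum>s\<in>S. smul (c s) s) \<in> N))"

text \<open>Fredholm operators in the Hilbert space \<open>V / N\<close>. Its elements are given by representatives
  in \<open>V\<close>, and the operator by the set \<open>G\<close> of all representatives of elements of its graph; \<open>N\<close> is
  \<open>{0}\<close> for \<^typ>\<open>hsum\<close> and consists of the functions vanishing almost everywhere for an \<open>L\<^sup>2\<close> space.
  The graph norm on the domain makes any operator bounded and does not enter the two dimensions.\<close>

definition fredholm ::
  "(complex \<Rightarrow> 'v \<Rightarrow> 'v) \<Rightarrow> 'v :: ab_group_add set \<Rightarrow> 'v set \<Rightarrow> ('v \<times> 'v) set \<Rightarrow> bool" where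
  "fredholm smul V N G \<longleftrightarrow>
    finite_dim_quotient smul {u. \<exists>v\<in>N. (u, v) \<in> G} N \<and>
    finite_dim_quotient smul V (Range G)"


section \<open>Spectral projections\<close>

definition orthogonal_projection :: "(hsum \<Rightarrow> hsum) \<Rightarrow> bool" where
  "orthogonal_projection P \<longleftrightarrow>
    bounded_op P \<and> (\<forall>x. P (P x) = P x) \<and> (\<forall>x y. cinner (P x) y = cinner x (P y))"

definition projection_valued_measure :: "(real set \<Rightarrow> hsum \<Rightarrow> hsum) \<Rightarrow> bool" where
  "projection_valued_measure E \<longleftrightarrow>
    (\<forall>S\<in>sets borel. orthogonal_projection (E S)) \<and> (\<forall>x. E UNIV x = x) \<and>
    (\<forall>S :: nat \<Rightarrow> real set. range S \<subseteq> sets borel \<longrightarrow> disjoint_family S \<longrightarrow>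
      (\<forall>x. (\<lambda>n. E (S n) x) sums E (\<Union>n. S n) x))"

text \<open>The measure \<open>S \<mapsto> \<langle>x, E(S) x\<rangle>\<close>.\<close>

definition scalar_measure :: "(real set \<Rightarrow> hsum \<Rightarrow> hsum) \<Rightarrow> hsum \<Rightarrow> real measure" where
  "scalar_measure E x = measure_of UNIV (sets borel) (\<lambda>S. ennreal ((norm (E S x))\<^sup>2))"

text \<open>\<open>A = \<integral> \<lambda> dE(\<lambda>)\<close>; by polarization the quadratic form on the domain determines \<open>A\<close>.\<close>

definition spectral_measure_of ::
  "hsum set \<Rightarrow> (hsum \<Rightarrow> hsum) \<Rightarrow> (real set \<Rightarrow> hsum \<Rightarrow> hsum) \<Rightarrow> bool" where
  "spectral_measure_of W A E \<longleftrightarrow>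
    projection_valued_measure E \<and>
    W = {x. (\<integral>\<^sup>+l. ennreal (l\<^sup>2) \<partial>scalar_measure E x) < \<infinity>} \<and>
    (\<forall>x\<in>W. cinner x (A x) = complex_of_real (\<integral>l. l \<partial>scalar_measure E x))"

text \<open>\<open>\<chi>\<^sub>S(A)\<close> for a self-adjoint operator \<open>A\<close> with domain \<open>W\<close> and a Borel set \<open>S\<close>; the spectral
  measure of \<open>A\<close> exists and is unique on Borel sets by the spectral theorem.\<close>

definition spectral_projection ::
  "hsum set \<Rightarrow> (hsum \<Rightarrow> hsum) \<Rightarrow> real set \<Rightarrow> hsum \<Rightarrow> hsum" where
  "spectral_projection W A S = (THE P. \<exists>E. spectral_measure_of W A E \<and> P = E S)"


section \<open>Families of operators and the operator \<open>D\<^sub>A\<^sub>P\<^sub>S\<close>\<close>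

definition strongly_C1 :: "real \<Rightarrow> hsum set \<Rightarrow> (real \<Rightarrow> hsum \<Rightarrow> hsum) \<Rightarrow> bool" where
  "strongly_C1 T W A \<longleftrightarrow>
    (\<forall>t\<in>{0..T}. bounded_op_on W (graph_norm (A 0)) (A t)) \<and>
    (\<exists>A'. (\<forall>t\<in>{0..T}. bounded_op_on W (graph_norm (A 0)) (A' t)) \<and>
      (\<forall>x\<in>W.
        (\<forall>t\<in>{0..T}. ((\<lambda>s. A s x) has_vector_derivative A' t x) (at t within {0..T})) \<and>
        continuous_on {0..T} (\<lambda>t. A' t x)))"

definition admissible_family :: "real \<Rightarrow> hsum set \<Rightarrow> (real \<Rightarrow> hsum \<Rightarrow> hsum) \<Rightarrow> bool" where
  "admissible_family T W A \<longleftrightarrow>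
    (\<forall>t\<in>{0..T}. self_adjoint W (A t) \<and> fredholm scaleC UNIV {0} (op_graph W (A t))) \<and>
    strongly_C1 T W A"

text \<open>\<open>f \<in> C\<^sup>1([0,T],W)\<close> with derivative \<open>f'\<close>, where \<open>N\<close> is the norm of \<open>W\<close>.\<close>

definition C1_with_deriv ::
  "real \<Rightarrow> hsum set \<Rightarrow> (hsum \<Rightarrow> real) \<Rightarrow> (real \<Rightarrow> hsum) \<Rightarrow> (real \<Rightarrow> hsum) \<Rightarrow> bool" where
  "C1_with_deriv T W N f f' \<longleftrightarrow>
    (\<forall>t\<in>{0..T}. f t \<in> W \<and> f' t \<in> W \<and>
      ((\<lambda>s. N ((f s - f t) /\<^sub>R (s - t) - f' t)) \<longlongrightarrow> 0) (at t within {0..T}) \<and>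
      ((\<lambda>s. N (f' s - f' t)) \<longlongrightarrow> 0) (at t within {0..T}))"

text \<open>\<open>L\<^sup>2([0,T],H)\<close> is represented by functions on the real line of which only the
  restriction to \<open>[0,T]\<close> matters, up to equality almost everywhere. As \<^typ>\<open>hsum\<close> is separable,
  Borel measurability is strong measurability.\<close>

definition L2_norm_sq :: "real \<Rightarrow> (real \<Rightarrow> hsum) \<Rightarrow> ennreal" where
  "L2_norm_sq T f = (\<integral>\<^sup>+t. ennreal ((norm (f t))\<^sup>2) \<partial>lebesgue_on {0..T})"

definition L2_functions :: "real \<Rightarrow> (real \<Rightarrow> hsum) set" where
  "L2_functions T = {f \<in> borel_measurable (lebesgue_on {0..T}). L2_norm_sq T f < \<infinity>}"

definition null_functions :: "real \<Rightarrow> (real \<Rightarrow> hsum) set" where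
  "null_functions T = {f \<in> L2_functions T. AE t in lebesgue_on {0..T}. f t = 0}"

definition D_smooth_graph ::
  "real \<Rightarrow> hsum set \<Rightarrow> (real \<Rightarrow> hsum \<Rightarrow> hsum) \<Rightarrow> ((real \<Rightarrow> hsum) \<times> (real \<Rightarrow> hsum)) set" where
  "D_smooth_graph T W A =
    {(f, \<lambda>t. f' t - \<i> *\<^sub>C A t (f t)) | f f'. C1_with_deriv T W (graph_norm (A 0)) f f'}"

definition D_graph ::
  "real \<Rightarrow> hsum set \<Rightarrow> (real \<Rightarrow> hsum \<Rightarrow> hsum) \<Rightarrow> ((real \<Rightarrow> hsum) \<times> (real \<Rightarrow> hsum)) set" where
  "D_graph T W A =
    {(f, g). f \<in> L2_functions T \<and> g \<in> L2_functions T \<and>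
      (\<forall>e>0. \<exists>(f0, g0) \<in> D_smooth_graph T W A.
        L2_norm_sq T (f - f0) < e \<and> L2_norm_sq T (g - g0) < e)}"

text \<open>Boundary values are those of the continuous representative \<open>h\<close>.\<close>

definition D_APS_graph ::
  "real \<Rightarrow> hsum set \<Rightarrow> (real \<Rightarrow> hsum \<Rightarrow> hsum) \<Rightarrow> ((real \<Rightarrow> hsum) \<times> (real \<Rightarrow> hsum)) set" where
  "D_APS_graph T W A =
    {(f, g) \<in> D_graph T W A.
      \<exists>h. continuous_on {0..T} h \<and> (AE t in lebesgue_on {0..T}. f t = h t) \<and>
        h 0 \<in> range (spectral_projection W (A 0) {..<0}) \<and>
        h T \<in> range (spectral_projection W (A T) {0..})}"

definition D_APS_fredholm :: "real \<Rightarrow> hsum set \<Rightarrow> (real \<Rightarrow> hsum \<Rightarrow> hsum) \<Rightarrow> bool" where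
  "D_APS_fredholm T W A \<longleftrightarrow>
    fredholm (\<lambda>c f t. c *\<^sub>C f t) (L2_functions T) (null_functions T) (D_APS_graph T W A)"


section \<open>The unperturbed operator\<close>

definition a_matrix :: "real \<Rightarrow> complex ^ 2 ^ 2" where
  "a_matrix l = vector [vector [- complex_of_real l, 0], vector [0, complex_of_real l]]"

definition A0_domain :: "(nat \<Rightarrow> real) \<Rightarrow> hsum set" where
  "A0_domain lam = {x. summable (\<lambda>i. (norm (a_matrix (lam i) *v block x i))\<^sup>2)}"

definition A0 :: "(nat \<Rightarrow> real) \<Rightarrow> hsum \<Rightarrow> hsum" where
  "A0 lam x = Abs_hsum (\<lambda>i. a_matrix (lam i) *v block x i)"

end

theory Submission
  imports Defs
begin

text \<open>
  Couple the two eigenvectors of every \<open>a\<^sub>i\<close> by a resonant perturbation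
  \<open>b\<^sub>i(t) = \<phi>(t) ((0, e\<^sup>-\<^sup>2\<^sup>i\<^sup>\<lambda>\<^sup>t), (e\<^sup>2\<^sup>i\<^sup>\<lambda>\<^sup>t, 0))\<close>, with \<open>\<lambda> = \<lambda>\<^sub>i\<close> and \<open>\<phi>\<close> independent of \<open>i\<close>. It is uniformly bounded, and
  its derivative grows only like \<open>\<lambda>\<^sub>i\<close>, which is bounded relative to the graph norm. In the rotating
  frame \<open>u = e\<^sup>i\<^sup>t\<^sup>a v\<close> the equation \<open>u' = i (a\<^sub>i + b\<^sub>i) u\<close> becomes \<open>v' = i \<phi>(t) ((0, 1), (1, 0)) v\<close>, whose flow is
  rotation by \<open>\<Phi> = \<integral>\<phi>\<close>. Choosing \<open>\<phi>(0) = \<phi>(T) = 0\<close> and \<open>\<Phi>(T) = \<pi> / 2\<close> gives \<open>A(0) = A(T) = A\<^sub>0\<close>,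
  while in each block the solution that starts in the negative eigenspace ends in the positive one.
  So every block contributes one dimension to the kernel of \<open>D\<^sub>A\<^sub>P\<^sub>S\<close>.
\<close>


subsection \<open>Blocks and coordinates\<close>

lemma hsum_eqI:
  assumes "\<And>i j. block x i $ j = block y i $ j"
  shows "x = y"
  using assms by (simp add: block_inject [symmetric] fun_eq_iff vec_eq_iff)

lemma summable_block: "summable (\<lambda>i. (norm (block x i))\<^sup>2)"
  using block [of x] by simp

lemma norm_hsum_power2: "(norm x)\<^sup>2 = (\<Sum>i. (norm (block x i))\<^sup>2)"
  by (simp add: power2_norm_eq_inner inner_hsum.rep_eq)

lemma norm_hsum_sums: "(\<lambda>i. (norm (block x i))\<^sup>2) sums (norm x)\<^sup>2"
  using summable_block [of x] by (simp add: norm_hsum_power2 sums_iff)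

lemmas block_simps = zero_hsum.rep_eq plus_hsum.rep_eq uminus_hsum.rep_eq minus_hsum.rep_eq
  scaleR_hsum.rep_eq scaleC.rep_eq

lemma block_sum: "block (\<Sum>k\<in>S. f k) i = (\<Sum>k\<in>S. block (f k) i)"
  by (induction S rule: infinite_finite_induct) (simp_all add: block_simps)

lemma block_scaleR: "block (r *\<^sub>R x) i $ j = of_real r * block x i $ j"
  by (simp add: block_simps complex_eq_iff)

lemma norm_le_if_block_le:
  assumes "\<And>i. norm (block y i) \<le> K * norm (block x i)" "0 \<le> K"
  shows "norm y \<le> K * norm x"
proof (rule power2_le_imp_le)
  have "(norm y)\<^sup>2 \<le> (\<Sum>i. K\<^sup>2 * (norm (block x i))\<^sup>2)"
    unfolding norm_hsum_power2
    by (intro suminf_le summable_mult summable_block)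
      (metis assms(1) norm_ge_zero power_mono power_mult_distrib)
  also have "\<dots> = (K * norm x)\<^sup>2"
    by (simp add: norm_hsum_power2 power_mult_distrib suminf_mult summable_block)
  finally show "(norm y)\<^sup>2 \<le> (K * norm x)\<^sup>2" .
qed (use assms in simp)

lemma norm_vec2_power2: "(norm (v :: complex ^ 2))\<^sup>2 = (norm (v $ 1))\<^sup>2 + (norm (v $ 2))\<^sup>2"
  by (simp add: norm_vec_def L2_set_def sum_2 add_nonneg_nonneg)

lemma norm_vec2_mult_le:
  assumes "\<And>j. norm (u $ j) \<le> K * norm (v $ j)" "0 \<le> K"
  shows "norm (u :: complex ^ 2) \<le> K * norm (v :: complex ^ 2)"
proof (rule power2_le_imp_le)
  show "(norm u)\<^sup>2 \<le> (K * norm v)\<^sup>2"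
    unfolding power_mult_distrib norm_vec2_power2 distrib_left
    unfolding power_mult_distrib [symmetric]
    by (intro add_mono power_mono assms) simp_all
qed (use assms in simp)

lemma scaleC_of_real: "of_real r *\<^sub>C x = r *\<^sub>R x"
  by (rule hsum_eqI) (simp add: block_simps complex_eq_iff)

lemma scaleC_eq_scaleR: "c *\<^sub>C x = Re c *\<^sub>R x + Im c *\<^sub>R (\<i> *\<^sub>C x)"
  by (rule hsum_eqI) (simp add: block_simps complex_eq_iff)

text \<open>Dominated convergence for the series of squared block norms: blockwise limits alone
  would not give norm convergence, and the blocks of the fixed vector \<open>x\<close> provide the
  summable majorant.\<close>

lemma tendsto_hsumI:
  assumes blocks: "\<And>i. ((\<lambda>s. block (y s) i) \<longlongrightarrow> block z i) F"
    and bound: "\<forall>\<^sub>F s in F. \<forall>i. norm (block (y s) i - block z i) \<le> K * norm (block x i)"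
  shows "(y \<longlongrightarrow> z) F"
proof (cases "F = bot")
  case False
  have "((\<lambda>s. \<Sum>i. (norm (block (y s) i - block z i))\<^sup>2) \<longlongrightarrow> (\<Sum>i. 0)) F"
  proof (rule tannerys_theorem [THEN conjunct2, THEN conjunct2])
    fix i
    show "((\<lambda>s. (norm (block (y s) i - block z i))\<^sup>2) \<longlongrightarrow> 0) F"
      using tendsto_power [OF tendsto_norm_zero [OF LIM_zero [OF blocks [of i]]], of 2] by simp
  next
    show "summable (\<lambda>i. K\<^sup>2 * (norm (block x i))\<^sup>2)"
      by (intro summable_mult summable_block)
    have "\<forall>\<^sub>F s in F. \<forall>i. norm ((norm (block (y s) i - block z i))\<^sup>2) \<le> K\<^sup>2 * (norm (block x i))\<^sup>2"
      using bound
    proof eventually_elim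
      case (elim s)
      then show ?case
        by (auto intro: power_mono simp flip: power_mult_distrib)
    qed
    then show "\<forall>\<^sub>F (i, s) in sequentially \<times>\<^sub>F F.
        norm ((norm (block (y s) i - block z i))\<^sup>2) \<le> K\<^sup>2 * (norm (block x i))\<^sup>2"
      unfolding eventually_prod_filter
      by (intro exI [of _ "\<lambda>_. True"] exI conjI) auto
  qed (use False in auto)
  then have "((\<lambda>s. (norm (y s - z))\<^sup>2) \<longlongrightarrow> 0) F"
    by (simp add: norm_hsum_power2 block_simps)
  then have "((\<lambda>s. sqrt ((norm (y s - z))\<^sup>2)) \<longlongrightarrow> sqrt 0) F"
    by (rule tendsto_real_sqrt)
  then show ?thesis
    by (simp add: tendsto_norm_zero_iff LIM_zero_iff)
qed simp


subsection \<open>Multiplication operators\<close>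

text \<open>The multiplier may be unbounded. Outside \<open>diag_dom m\<close> the argument of
  \<open>Abs_hsum\<close> is not square summable and the value carries no meaning, so coordinates
  are computed only under a domain hypothesis.\<close>

definition diag :: "(nat \<Rightarrow> 2 \<Rightarrow> complex) \<Rightarrow> hsum \<Rightarrow> hsum" where
  "diag m x = Abs_hsum (\<lambda>i. \<chi> j. m i j * block x i $ j)"

definition diag_dom :: "(nat \<Rightarrow> 2 \<Rightarrow> complex) \<Rightarrow> hsum set" where
  "diag_dom m = {x. summable (\<lambda>i. (norm (\<chi> j. m i j * block x i $ j))\<^sup>2)}"

lemma block_diag:
  assumes "x \<in> diag_dom m"
  shows "block (diag m x) i $ j = m i j * block x i $ j"
  using assms by (simp add: diag_def diag_dom_def Abs_hsum_inverse)

lemma diag_domI: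
  assumes "\<And>i j. norm (m i j * block x i $ j) \<le> norm (block y i $ j)"
  shows "x \<in> diag_dom m"
proof -
  have "norm (\<chi> j. m i j * block x i $ j) \<le> 1 * norm (block y i)" for i
    by (rule norm_vec2_mult_le) (use assms in simp_all)
  then show ?thesis
    unfolding diag_dom_def mem_Collect_eq
    by (intro summable_comparison_test [OF _ summable_block [of y]] exI [of _ 0])
      (simp add: power_mono)
qed

lemma diag_dom_bounded:
  assumes "\<And>i j. norm (m i j) \<le> K"
  shows "x \<in> diag_dom m"
proof (rule diag_domI [where y = "K *\<^sub>R x"])
  show "norm (m i j * block x i $ j) \<le> norm (block (K *\<^sub>R x) i $ j)" for i j
    using order_trans [OF assms [of i j] abs_ge_self]
    by (simp add: block_simps norm_mult mult_right_mono)
qed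

lemma diag_dom_mono:
  assumes "x \<in> diag_dom m" "\<And>i j. norm (m' i j) \<le> K * norm (m i j)"
  shows "x \<in> diag_dom m'"
proof (rule diag_domI [where y = "K *\<^sub>R diag m x"])
  show "norm (m' i j * block x i $ j) \<le> norm (block (K *\<^sub>R diag m x) i $ j)" for i j
  proof -
    have "norm (m' i j) \<le> \<bar>K\<bar> * norm (m i j)"
      by (rule order_trans [OF assms(2)]) (simp add: mult_right_mono)
    then show ?thesis
      by (simp add: block_simps norm_mult block_diag assms mult_right_mono flip: mult.assoc)
  qed
qed

text \<open>The source of vectors in the domain of an unbounded \<open>m\<close>: apply first a
  multiplier \<open>m'\<close> that decays or cuts off enough to make the product bounded.\<close>

lemma diag_dom_diag:
  assumes "x \<in> diag_dom m'" "\<And>i j. norm (m i j * m' i j) \<le> K"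
  shows "diag m' x \<in> diag_dom m"
proof (rule diag_domI [where y = "K *\<^sub>R x"])
  show "norm (m i j * block (diag m' x) i $ j) \<le> norm (block (K *\<^sub>R x) i $ j)" for i j
    using order_trans [OF assms(2) [of i j] abs_ge_self]
    by (simp add: block_diag assms(1) block_simps norm_mult mult_right_mono flip: mult.assoc)
qed

lemma clinear_on_diag: "clinear_on (diag_dom m) (diag m)"
proof -
  have 0: "0 \<in> diag_dom m"
    by (simp add: diag_dom_def block_simps vec_eq_iff zero_vec_def [symmetric])
  have add: "x + y \<in> diag_dom m" if "x \<in> diag_dom m" "y \<in> diag_dom m" for x y
    by (rule diag_domI [where y = "diag m x + diag m y"])
      (simp add: that block_diag block_simps distrib_left)
  have sc: "c *\<^sub>C x \<in> diag_dom m" if "x \<in> diag_dom m" for c x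
    by (rule diag_domI [where y = "c *\<^sub>C diag m x"])
      (simp add: that block_diag block_simps mult_ac)
  show ?thesis
    unfolding clinear_on_def
    by (auto intro!: hsum_eqI simp: 0 add sc block_diag block_simps algebra_simps)
qed

lemma clinear_on_diag_UNIV:
  assumes "\<And>i j. norm (m i j) \<le> K"
  shows "clinear_on UNIV (diag m)"
proof -
  have "diag_dom m = UNIV"
    using diag_dom_bounded [of m K] assms by blast
  then show ?thesis
    using clinear_on_diag [of m] by simp
qed

lemma norm_diag_le:
  assumes "x \<in> diag_dom m" "x \<in> diag_dom m'" "\<And>i j. norm (m' i j) \<le> K * norm (m i j)" "0 \<le> K"
  shows "norm (diag m' x) \<le> K * norm (diag m x)"
  by (intro norm_le_if_block_le norm_vec2_mult_le)
    (use assms in \<open>simp_all add: block_diag norm_mult mult_right_mono flip: mult.assoc\<close>)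

lemma diag_one: "diag (\<lambda>_ _. 1) x = x"
  by (rule hsum_eqI) (simp add: block_diag diag_dom_bounded [where K = 1])

text \<open>The majorant \<open>b\<close> may be unbounded as long as \<open>x\<close> lies in its
  domain. A constant \<open>b\<close> serves cutoffs and spectral sums, and \<open>b\<close> of
  order \<open>lam i\<close> serves derivatives of the phases.\<close>

lemma tendsto_diag:
  assumes dom: "\<And>s. x \<in> diag_dom (m s)" "x \<in> diag_dom m0" "x \<in> diag_dom b"
    and lim: "\<And>i j. ((\<lambda>s. m s i j) \<longlongrightarrow> m0 i j) F"
    and bound: "\<forall>\<^sub>F s in F. \<forall>i j. norm (m s i j - m0 i j) \<le> norm (b i j)"
  shows "((\<lambda>s. diag (m s) x) \<longlongrightarrow> diag m0 x) F"
proof (rule tendsto_hsumI [where x = "diag b x" and K = 1])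
  show "((\<lambda>s. block (diag (m s) x) i) \<longlongrightarrow> block (diag m0 x) i) F" for i
    by (rule vec_tendstoI) (simp add: block_diag dom lim tendsto_mult_right)
  show "\<forall>\<^sub>F s in F. \<forall>i. norm (block (diag (m s) x) i - block (diag m0 x) i)
      \<le> 1 * norm (block (diag b x) i)"
    using bound
  proof eventually_elim
    case (elim s)
    show ?case
    proof
      fix i
      show "norm (block (diag (m s) x) i - block (diag m0 x) i) \<le> 1 * norm (block (diag b x) i)"
        by (rule norm_vec2_mult_le)
          (use elim in \<open>simp_all add: block_diag dom norm_mult mult_right_mono
            flip: left_diff_distrib\<close>)
    qed
  qed
qed

section \<open>Coordinate swap and embedding of a single block\<close>

lift_definition swap :: "hsum \<Rightarrow> hsum" is "\<lambda>x i. \<chi> j. x i $ (if j = 1 then 2 else 1)"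
  by (simp add: norm_vec2_power2 add.commute)

lemma block_swap [simp]: "block (swap x) i $ 1 = block x i $ 2" "block (swap x) i $ 2 = block x i $ 1"
  by (simp_all add: swap.rep_eq)

lemma norm_swap: "norm (swap x) = norm x"
proof (rule power2_eq_imp_eq)
  show "(norm (swap x))\<^sup>2 = (norm x)\<^sup>2"
    by (simp add: norm_hsum_power2 norm_vec2_power2 add.commute)
qed simp_all

lemma swap_linear: "swap (x + y) = swap x + swap y" "swap (c *\<^sub>C x) = c *\<^sub>C swap x"
  by (rule hsum_eqI, simp add: swap.rep_eq block_simps)+

lift_definition blk :: "nat \<Rightarrow> complex ^ 2 \<Rightarrow> hsum" is "\<lambda>i v k. if k = i then v else 0"
proof -
  fix i :: nat and v :: "complex ^ 2"
  show "summable (\<lambda>k. (norm (if k = i then v else 0))\<^sup>2)"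
    by (rule summable_finite [of "{i}"]) auto
qed

lemma blk_linear:
  "blk i (u + v) = blk i u + blk i v" "blk i (u - v) = blk i u - blk i v"
  "blk i (r *\<^sub>R v) = r *\<^sub>R blk i v" "blk i (c *s v) = c *\<^sub>C blk i v"
  by (rule hsum_eqI, simp add: blk.rep_eq block_simps)+

lemma inner_blk: "inner (blk i v) x = inner v (block x i)"
proof -
  have "inner (block (blk i v) k) (block x k) = (if k = i then inner v (block x i) else 0)" for k
    by (simp add: blk.rep_eq)
  then have "inner (blk i v) x = (\<Sum>k. if k = i then inner v (block x i) else 0)"
    by (simp add: inner_hsum.rep_eq)
  also have "\<dots> = inner v (block x i)"
    using sums_single [of i "\<lambda>_. inner v (block x i)"] by (simp add: sums_iff)
  finally show ?thesis .
qed

lemma norm_blk: "norm (blk i v) = norm v"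
  by (simp add: norm_eq_sqrt_inner inner_blk blk.rep_eq)

section \<open>The complex inner product\<close>

lemma cinner_blk_axis: "cinner (blk i (axis j 1)) x = block x i $ j"
proof -
  have "(\<Sum>l\<in>UNIV. cnj (block (blk i (axis j 1)) k $ l) * block x k $ l) =
      (if k = i then block x i $ j else 0)" for k
    by (simp add: blk.rep_eq axis_def if_distrib [of cnj] if_distrib [of "\<lambda>c. c * _"]
        sum.delta cong: if_cong)
  then have "cinner (blk i (axis j 1)) x = (\<Sum>k. if k = i then block x i $ j else 0)"
    by (simp add: cinner_def)
  also have "\<dots> = block x i $ j"
    using sums_single [of i "\<lambda>_. block x i $ j"] by (simp add: sums_iff)
  finally show ?thesis .
qed

lemma cinner_eqI:
  assumes "\<And>u. cinner u x = cinner u y"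
  shows "x = y"
  by (rule hsum_eqI) (metis assms cinner_blk_axis)

text \<open>\<open>cinner\<close> is conjugate linear in its first argument, so multiplying that
  argument by \<open>\<i>\<close> turns the imaginary part into a real part. This carries results on
  the real inner product over to the complex one.\<close>

lemma cinner_eq_inner:
  "cinner x y = complex_of_real (inner x y) + \<i> * complex_of_real (inner (\<i> *\<^sub>C x) y)"
proof -
  have "(\<Sum>j\<in>UNIV. cnj (block x i $ j) * block y i $ j) =
      complex_of_real (inner (block x i) (block y i)) +
      \<i> * complex_of_real (inner (block (\<i> *\<^sub>C x) i) (block y i))" for i
    by (simp add: sum_2 inner_vec_def block_simps complex_eq_iff inner_complex_def)
  moreover have "(\<lambda>i. complex_of_real (inner (block x i) (block y i)) +
      \<i> * complex_of_real (inner (block (\<i> *\<^sub>C x) i) (block y i))) sums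
      (complex_of_real (inner x y) + \<i> * complex_of_real (inner (\<i> *\<^sub>C x) y))"
    by (intro sums_add sums_mult sums_of_real)
      (simp_all add: inner_hsum.rep_eq summable_sums square_summable_inner summable_block)
  ultimately show ?thesis
    by (simp add: cinner_def sums_iff)
qed

lemma Re_cinner: "Re (cinner x y) = inner x y"
  by (simp add: cinner_eq_inner)


subsection \<open>Spectral measures\<close>

lemma clinear_on_diff:
  assumes "clinear_on W A" "x \<in> W" "y \<in> W"
  shows "x - y \<in> W" "A (x - y) = A x - A y"
proof -
  have neg: "x - y = x + (-1) *\<^sub>C y" "A x - A y = A x + (-1) *\<^sub>C A y"
    by (rule hsum_eqI, simp add: block_simps)+
  show "x - y \<in> W" "A (x - y) = A x - A y"
    unfolding neg using assms unfolding clinear_on_def by metis+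
qed

lemma orthogonal_projectionD:
  assumes "orthogonal_projection P"
  shows "P (x + y) = P x + P y" "P (x - y) = P x - P y" "P (P x) = P x"
    "inner (P x) y = inner x (P y)" "(norm (P x))\<^sup>2 = inner x (P x)" "norm (P x) \<le> norm x"
proof -
  have cl: "clinear_on UNIV P"
    using assms by (simp add: orthogonal_projection_def bounded_op_on_def)
  show "P (x + y) = P x + P y"
    using cl by (simp add: clinear_on_def)
  show "P (x - y) = P x - P y"
    using clinear_on_diff [OF cl] by simp
  show idem: "P (P x) = P x"
    using assms by (simp add: orthogonal_projection_def)
  show sym: "inner (P x) y = inner x (P y)" for x y
    using assms by (simp add: orthogonal_projection_def flip: Re_cinner)
  show sq: "(norm (P x))\<^sup>2 = inner x (P x)"
    by (simp add: power2_norm_eq_inner sym idem)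
  then have "norm (P x) * norm (P x) \<le> norm x * norm (P x)"
    using norm_cauchy_schwarz [of x "P x"] by (simp add: power2_eq_square)
  then show "norm (P x) \<le> norm x"
    by (cases "norm (P x) = 0") auto
qed

section \<open>Projection-valued measures and their scalar measures\<close>

context
  fixes E :: "real set \<Rightarrow> hsum \<Rightarrow> hsum"
  assumes pvm: "projection_valued_measure E"
begin

lemma pvm_projection: "S \<in> sets borel \<Longrightarrow> orthogonal_projection (E S)"
  using pvm by (simp add: projection_valued_measure_def)

lemma pvm_UNIV: "E UNIV x = x"
  using pvm by (simp add: projection_valued_measure_def)

lemma pvm_sums:
  fixes S :: "nat \<Rightarrow> real set"
  shows "range S \<subseteq> sets borel \<Longrightarrow> disjoint_family S \<Longrightarrow> (\<lambda>n. E (S n) x) sums E (\<Union>n. S n) x"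
  using pvm by (simp add: projection_valued_measure_def)

text \<open>Countable additivity for a sequence of empty sets yields a convergent series with
  constant terms.\<close>

lemma pvm_empty: "E {} x = 0"
proof -
  have "(\<lambda>n :: nat. E {} x) sums E {} x"
    using pvm_sums [of "\<lambda>_. {}" x] by (simp add: disjoint_family_on_def)
  then have "(\<lambda>n :: nat. E {} x) \<longlonglongrightarrow> 0"
    using sums_minus sums_iff summable_LIMSEQ_zero by blast
  then show ?thesis
    by (simp add: LIMSEQ_const_iff)
qed

lemma pvm_Un:
  assumes "S \<in> sets borel" "S' \<in> sets borel" "S \<inter> S' = {}"
  shows "E (S \<union> S') x = E S x + E S' x"
proof -
  have "disjoint_family (binaryset S S')"
    using assms(3) by (auto simp: disjoint_family_on_def binaryset_def)
  then have "(\<lambda>n. E (binaryset S S' n) x) sums E (S \<union> S') x"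
    using pvm_sums [of "binaryset S S'" x] assms
    by (simp add: range_binaryset_eq UN_binaryset_eq)
  moreover have "(\<lambda>n. E (binaryset S S' n) x) sums (\<Sum>n\<in>{0, 1}. E (binaryset S S' n) x)"
    by (rule sums_finite) (auto simp: binaryset_def pvm_empty)
  ultimately have "E (S \<union> S') x = (\<Sum>n\<in>{0, 1}. E (binaryset S S' n) x)"
    by (rule sums_unique2)
  then show ?thesis
    by (simp add: binaryset_def)
qed

text \<open>For z in the range of \<open>E S'\<close>, additivity gives the Pythagorean identity for
  \<open>E (S \<union> S') z\<close>. Its norm is at most that of z, which \<open>E S' z\<close>
  already attains, so nothing is left for \<open>E S z\<close>.\<close>

lemma pvm_disjoint:
  assumes "S \<in> sets borel" "S' \<in> sets borel" "S \<inter> S' = {}"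
  shows "E S (E S' x) = 0"
proof -
  define z where "z = E S' x"
  have z: "E S' z = z"
    unfolding z_def by (rule orthogonal_projectionD(3) [OF pvm_projection [OF assms(2)]])
  have "(norm (E S z))\<^sup>2 + (norm (E S' z))\<^sup>2 = (norm (E (S \<union> S') z))\<^sup>2"
    using assms orthogonal_projectionD(5) [OF pvm_projection, of S z]
      orthogonal_projectionD(5) [OF pvm_projection, of S' z]
      orthogonal_projectionD(5) [OF pvm_projection, of "S \<union> S'" z]
    by (simp add: pvm_Un inner_add_right)
  also have "\<dots> \<le> (norm z)\<^sup>2"
    using assms by (intro power_mono orthogonal_projectionD pvm_projection) auto
  finally show ?thesis
    unfolding z_def [symmetric] by (simp add: z)
qed

text \<open>Cut each of the two sets along the other. The products of disjoint pieces vanish and the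
  common piece is idempotent.\<close>

lemma pvm_Int:
  assumes "S \<in> sets borel" "S' \<in> sets borel"
  shows "E S (E S' x) = E (S \<inter> S') x"
proof -
  have split: "E U y = E (U \<inter> V) y + E (U - V) y" if "U \<in> sets borel" "V \<in> sets borel" for U V y
    using that by (subst pvm_Un [symmetric]) (auto simp: Int_Diff_Un)
  have "E S (E S' x) = E S (E (S' \<inter> S) x) + E S (E (S' - S) x)"
    using assms by (simp add: split [of S' S] orthogonal_projectionD(1) [OF pvm_projection])
  also have "E S (E (S' - S) x) = 0"
    using assms by (intro pvm_disjoint) auto
  also have "E S (E (S' \<inter> S) x) = E (S \<inter> S') (E (S' \<inter> S) x) + E (S - S') (E (S' \<inter> S) x)"
    using assms by (rule split)
  also have "E (S - S') (E (S' \<inter> S) x) = 0"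
    using assms by (intro pvm_disjoint) auto
  also have "E (S \<inter> S') (E (S' \<inter> S) x) = E (S \<inter> S') x"
    using assms by (simp add: Int_commute orthogonal_projectionD(3) pvm_projection)
  finally show ?thesis by simp
qed

text \<open>\<open>measure_of\<close> returns the prescribed values only for a countably additive
  set function. The squared norm equals \<open>inner x (E S x)\<close>, and this bounded linear
  functional of \<open>E S x\<close> inherits additivity.\<close>

lemma emeasure_scalar_measure:
  assumes "S \<in> sets borel"
  shows "emeasure (scalar_measure E x) S = ennreal ((norm (E S x))\<^sup>2)"
proof (rule emeasure_measure_of [OF scalar_measure_def])
  show "countably_additive (sets (scalar_measure E x)) (\<lambda>S. ennreal ((norm (E S x))\<^sup>2))"
    unfolding countably_additive_def
  proof (intro allI impI)
    fix F :: "nat \<Rightarrow> real set"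
    assume F: "range F \<subseteq> sets (scalar_measure E x)" "disjoint_family F"
    have borel: "F n \<in> sets borel" for n
      using F(1) sets.sigma_sets_eq [of "borel :: real measure"]
      by (auto simp: scalar_measure_def)
    have "(\<lambda>n. inner x (E (F n) x)) sums inner x (E (\<Union>n. F n) x)"
      using borel F by (intro bounded_linear.sums [OF bounded_linear_inner_right] pvm_sums) auto
    then have "(\<lambda>n. (norm (E (F n) x))\<^sup>2) sums (norm (E (\<Union>n. F n) x))\<^sup>2"
      using borel by (simp add: orthogonal_projectionD(5) pvm_projection sets.countable_UN)
    then show "(\<Sum>n. ennreal ((norm (E (F n) x))\<^sup>2)) = ennreal ((norm (E (\<Union>n. F n) x))\<^sup>2)"
      by (intro suminf_ennreal_eq) auto
  qed
qed (use assms sets.sigma_sets_eq [of "borel :: real measure"] in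
    \<open>auto simp: positive_def pvm_empty scalar_measure_def\<close>)

lemma sets_scalar_measure: "sets (scalar_measure E x) = sets borel"
  using sets.sigma_sets_eq [of "borel :: real measure"] by (simp add: scalar_measure_def)

lemma scalar_measure_projection:
  assumes "S \<in> sets borel"
  shows "scalar_measure E (E S x) = density (scalar_measure E x) (indicator S)"
proof (rule measure_eqI)
  fix U assume "U \<in> sets (scalar_measure E (E S x))"
  then have U: "U \<in> sets borel"
    by (simp add: sets_scalar_measure)
  note [measurable] = assms U and [measurable_cong] = sets_scalar_measure
  have "emeasure (density (scalar_measure E x) (indicator S)) U =
      emeasure (scalar_measure E x) (S \<inter> U)"
    by (subst emeasure_density) (simp_all add: sets_scalar_measure U flip: indicator_inter_arith)
  then show "emeasure (scalar_measure E (E S x)) U = emeasure (density (scalar_measure E x) (indicator S)) U"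
    using assms U by (simp add: emeasure_scalar_measure pvm_Int Int_commute)
qed (simp add: sets_scalar_measure)

text \<open>The scalar measure has total mass \<open>(norm x)\<^sup>2\<close>, so a finite second
  moment controls the first through |l| \<le> 1 + l^2.\<close>

lemma integrable_scalar_measure:
  assumes "(\<integral>\<^sup>+l. ennreal (l\<^sup>2) \<partial>scalar_measure E x) < \<infinity>"
  shows "integrable (scalar_measure E x) (\<lambda>l. l)"
proof (rule integrableI_bounded)
  note [measurable_cong] = sets_scalar_measure
  have "(\<integral>\<^sup>+l. ennreal (norm l) \<partial>scalar_measure E x) \<le>
      (\<integral>\<^sup>+l. 1 + ennreal (l\<^sup>2) \<partial>scalar_measure E x)"
  proof (rule nn_integral_mono)
    fix l :: real
    have "norm l \<le> 1 + l\<^sup>2"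
      using sum_squares_bound [of 1 "\<bar>l\<bar>"] by simp
    then show "ennreal (norm l) \<le> 1 + ennreal (l\<^sup>2)"
      by (metis ennreal_1 ennreal_leI ennreal_plus zero_le_one zero_le_power2)
  qed
  also have "\<dots> = emeasure (scalar_measure E x) UNIV + (\<integral>\<^sup>+l. ennreal (l\<^sup>2) \<partial>scalar_measure E x)"
    by (subst nn_integral_add) (measurable, simp add: scalar_measure_def space_measure_of_conv)
  also have "\<dots> < \<infinity>"
    using assms by (simp add: emeasure_scalar_measure)
  finally show "(\<integral>\<^sup>+l. ennreal (norm l) \<partial>scalar_measure E x) < \<infinity>" .
qed (simp add: measurable_cong_sets [OF sets_scalar_measure refl])

end

section \<open>The action of a spectral measure on eigenvectors\<close>

context
  fixes W A E
  assumes spec: "spectral_measure_of W A E" and sa: "self_adjoint W A"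
begin

lemma spectral_pvm: "projection_valued_measure E"
  using spec by (simp add: spectral_measure_of_def)

text \<open>The scalar measure of \<open>E S x\<close> is that of \<open>x\<close> restricted to
  \<open>S\<close>, so the second moment cannot grow and the quadratic form becomes an integral over
  \<open>S\<close>.\<close>

lemma spectral_restrict:
  assumes "x \<in> W" "S \<in> sets borel"
  shows "E S x \<in> W"
    and "inner (E S x) (A (E S x)) = (\<integral>l. indicator S l * l \<partial>scalar_measure E x)"
    and "integrable (scalar_measure E x) (\<lambda>l. indicator S l * l)"
proof -
  note [measurable] = assms(2)
  note [measurable_cong] = sets_scalar_measure [OF spectral_pvm]
  have W: "y \<in> W \<longleftrightarrow> (\<integral>\<^sup>+l. ennreal (l\<^sup>2) \<partial>scalar_measure E y) < \<infinity>" for y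
    using spec unfolding spectral_measure_of_def by blast
  have "(\<integral>\<^sup>+l. ennreal (l\<^sup>2) \<partial>scalar_measure E (E S x)) =
      (\<integral>\<^sup>+l. indicator S l * ennreal (l\<^sup>2) \<partial>scalar_measure E x)"
    by (simp add: scalar_measure_projection [OF spectral_pvm assms(2)] nn_integral_density)
  also have "\<dots> \<le> (\<integral>\<^sup>+l. ennreal (l\<^sup>2) \<partial>scalar_measure E x)"
    by (intro nn_integral_mono) (simp split: split_indicator)
  also have "\<dots> < \<infinity>"
    using assms W by simp
  finally show *: "E S x \<in> W"
    using W by simp
  have "inner (E S x) (A (E S x)) = (\<integral>l. l \<partial>scalar_measure E (E S x))"
    using spec * unfolding spectral_measure_of_def by (simp flip: Re_cinner)
  also have "\<dots> = (\<integral>l. indicator S l * l \<partial>scalar_measure E x)"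
    unfolding scalar_measure_projection [OF spectral_pvm assms(2)] ennreal_indicator [symmetric]
    by (subst integral_density) simp_all
  finally show "inner (E S x) (A (E S x)) = (\<integral>l. indicator S l * l \<partial>scalar_measure E x)" .
  show "integrable (scalar_measure E x) (\<lambda>l. indicator S l * l)"
    using integrable_mult_indicator [OF _ integrable_scalar_measure [OF spectral_pvm], of S x] assms W
    by (simp add: sets_scalar_measure [OF spectral_pvm])
qed

text \<open>Split \<open>e\<close> into its parts u and v on the negative and the nonnegative
  half-line. The quadratic form of \<open>A\<close> is at most 0 on u and at least 0 on v, yet it
  equals \<open>c\<close> times the squared norm on both. Hence the part whose sign disagrees with
  \<open>c\<close> vanishes.\<close>

lemma spectral_eigenvector:
  assumes e: "e \<in> W" "A e = c *\<^sub>R e"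
  shows "c < 0 \<Longrightarrow> E {..<0} e = e" "0 < c \<Longrightarrow> E {..<0} e = 0" "E {0..} e = e - E {..<0} e"
proof -
  define u v where "u = E {..<0} e" and "v = E {0..} e"
  have W: "u \<in> W" "v \<in> W"
    unfolding u_def v_def using e by (simp_all add: spectral_restrict)
  have "{..<0} \<union> {0..} = (UNIV :: real set)" "{..<0} \<inter> {0..} = ({} :: real set)"
    by auto
  then have uv: "e = u + v"
    using pvm_Un [OF spectral_pvm, of "{..<0}" "{0..}" e] pvm_UNIV [OF spectral_pvm, of e]
    by (simp add: u_def v_def)
  then show "E {0..} e = e - E {..<0} e"
    unfolding u_def v_def by (metis add_diff_cancel_left')
  have add: "A e = A u + A v"
    using sa W uv by (simp add: self_adjoint_def clinear_on_def)
  have sym: "inner x (A y) = inner (A x) y" if "x \<in> W" "y \<in> W" for x y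
  proof -
    have "(y, A y) \<in> adjoint_graph W A"
      using sa that unfolding self_adjoint_def op_graph_def by blast
    then show ?thesis
      using that by (simp add: adjoint_graph_def flip: Re_cinner)
  qed
  have orth: "inner u v = 0"
    unfolding u_def v_def
    using orthogonal_projectionD(4) [OF pvm_projection [OF spectral_pvm], of "{..<0}"]
      pvm_disjoint [OF spectral_pvm, of "{..<0}" "{0..}"] \<open>{..<0} \<inter> {0..} = {}\<close>
    by simp
  \<comment> \<open>The form at \<open>e\<close> is the sum of the forms at \<open>u\<close> and
    \<open>v\<close>, since the integral splits over the half-lines. Comparison with the expansion
    of the form at \<open>u + v\<close> kills the cross term, and pairing \<open>A e = c e\<close>
    with \<open>u\<close> or \<open>v\<close> then determines both forms.\<close>
  have "inner e (A e) = (\<integral>l. indicator {..<0} l * l + indicator {0..} l * l \<partial>scalar_measure E e)"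
    using spectral_restrict(2) [of e UNIV] e
    by (simp add: pvm_UNIV [OF spectral_pvm] indicator_def if_distrib flip: distrib_right cong: if_cong)
      (auto intro!: Bochner_Integration.integral_cong)
  also have "\<dots> = inner u (A u) + inner v (A v)"
    using e by (simp add: u_def v_def spectral_restrict)
  finally have "inner u (A v) = 0"
    using sym [OF W] unfolding add by (simp add: uv inner_simps inner_commute)
  then have u: "inner u (A u) = c * (norm u)\<^sup>2" and v: "inner v (A v) = c * (norm v)\<^sup>2"
    using e(2) add sym [OF W] orth
    by (simp_all add: uv power2_norm_eq_inner inner_commute algebra_simps)
      (metis add.right_neutral add.left_neutral inner_add_right inner_commute inner_scaleR_right)+
  have "(\<integral>l. indicator {..<0} l * l \<partial>scalar_measure E e) \<le> (\<integral>l. 0 \<partial>scalar_measure E e)"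
    using e by (intro integral_mono spectral_restrict) (auto split: split_indicator)
  then have "inner u (A u) \<le> 0"
    unfolding u_def using e by (simp add: spectral_restrict)
  moreover have "0 \<le> inner v (A v)"
    unfolding v_def using e
    by (simp add: spectral_restrict) (auto intro!: integral_nonneg split: split_indicator)
  ultimately show "c < 0 \<Longrightarrow> E {..<0} e = e" "0 < c \<Longrightarrow> E {..<0} e = 0"
    using uv unfolding u v u_def [symmetric]
    by (auto simp: zero_le_mult_iff mult_le_0_iff)
qed

end

subsection \<open>The spectral measure of a real multiplication operator\<close>

abbreviation rdiag :: "(nat \<Rightarrow> 2 \<Rightarrow> real) \<Rightarrow> hsum \<Rightarrow> hsum" where
  "rdiag m \<equiv> diag (\<lambda>i j. complex_of_real (m i j))"

abbreviation rdiag_dom :: "(nat \<Rightarrow> 2 \<Rightarrow> real) \<Rightarrow> hsum set" where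
  "rdiag_dom m \<equiv> diag_dom (\<lambda>i j. complex_of_real (m i j))"

text \<open>The functional calculus of a multiplication operator: apply the indicator to the
  multiplier.\<close>

definition diag_pvm :: "(nat \<Rightarrow> 2 \<Rightarrow> real) \<Rightarrow> real set \<Rightarrow> hsum \<Rightarrow> hsum" where
  "diag_pvm m S = rdiag (\<lambda>i j. indicator S (m i j))"

lemma diag_pvm_dom: "x \<in> rdiag_dom (\<lambda>i j. indicator S (m i j))"
  by (rule diag_dom_bounded [where K = 1]) (simp split: split_indicator)

lemma block_diag_pvm: "block (diag_pvm m S x) i $ j = of_real (indicator S (m i j)) * block x i $ j"
  by (simp add: diag_pvm_def block_diag diag_pvm_dom)

lemma cinner_diag_sym:
  assumes "x \<in> rdiag_dom m" "y \<in> rdiag_dom m"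
  shows "cinner (rdiag m x) y = cinner x (rdiag m y)"
  by (simp add: cinner_def block_diag assms mult_ac)

lemma norm_diag_pvm_le: "norm (diag_pvm m S x) \<le> norm x"
  using norm_le_if_block_le [of "diag_pvm m S x" 1 x] norm_vec2_mult_le [of _ 1]
  by (simp add: block_diag_pvm norm_mult split: split_indicator)

lemma pvm_diag: "projection_valued_measure (diag_pvm m)"
  unfolding projection_valued_measure_def
proof (intro conjI allI ballI impI)
  fix S :: "real set"
  have lin: "clinear_on UNIV (diag_pvm m S)"
    unfolding diag_pvm_def
    by (rule clinear_on_diag_UNIV [where K = 1]) (simp split: split_indicator)
  show "orthogonal_projection (diag_pvm m S)"
    unfolding orthogonal_projection_def bounded_op_on_def
    by (intro conjI allI lin exI [of _ 1])
      (auto simp: diag_pvm_def cinner_diag_sym diag_pvm_dom norm_diag_pvm_le [unfolded diag_pvm_def]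
        intro!: hsum_eqI simp: block_diag split: split_indicator)
next
  show "diag_pvm m UNIV x = x" for x
    by (rule hsum_eqI) (simp add: block_diag_pvm)
next
  fix S :: "nat \<Rightarrow> real set" and x
  assume disj: "disjoint_family S"
  have ind: "(\<Sum>k<n. indicator (S k) l) = (indicator (\<Union>k<n. S k) l :: real)" for n l
    using disj by (intro indicator_UN_disjoint [symmetric])
      (auto simp: disjoint_family_on_def)
  have "(\<Sum>k<n. diag_pvm m (S k) x) = diag_pvm m (\<Union>k<n. S k) x" for n
    by (rule hsum_eqI) (simp add: block_sum block_diag_pvm flip: ind sum_distrib_right)
  \<comment> \<open>The partial sums are again indicator multipliers. They converge at each
    coordinate and stay within distance 1 of the limit.\<close>
  moreover have "(\<lambda>n. diag_pvm m (\<Union>k<n. S k) x) \<longlonglongrightarrow> diag_pvm m (\<Union>n. S n) x"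
    unfolding diag_pvm_def
  proof (rule tendsto_diag [where b = "\<lambda>_ _. 1"])
    fix i j
    have "(\<lambda>n. indicator (\<Union>k<n. S k) (m i j) :: real) \<longlonglongrightarrow> indicator (\<Union>n. S n) (m i j)"
      by (rule LIMSEQ_indicator_UN)
    then show "(\<lambda>n. complex_of_real (indicator (\<Union>k<n. S k) (m i j))) \<longlonglongrightarrow>
        complex_of_real (indicator (\<Union>n. S n) (m i j))"
      by (rule tendsto_of_real)
  qed (use diag_dom_bounded [where K = 1] in \<open>auto simp: diag_pvm_dom split: split_indicator\<close>)
  ultimately show "(\<lambda>n. diag_pvm m (S n) x) sums diag_pvm m (\<Union>n. S n) x"
    by (simp add: sums_def)
qed

lemma nn_integral_diag_pvm:
  assumes [measurable]: "f \<in> borel_measurable borel"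
  shows "(\<integral>\<^sup>+l. f l \<partial>scalar_measure (diag_pvm m) x) =
    (\<Sum>i. \<Sum>j\<in>UNIV. ennreal ((norm (block x i $ j))\<^sup>2) * f (m i j))"
proof -
  \<comment> \<open>The scalar measure is pure point: coordinate (i, j) contributes its squared
    modulus as mass at \<open>m i j\<close>. Written as an image of a weighted counting measure, its
    integrals are sums.\<close>
  define M where "M = distr (density (count_space UNIV)
    (\<lambda>(i, j). ennreal ((norm (block x i $ j))\<^sup>2))) borel (\<lambda>(i, j). m i j)"
  have M: "(\<integral>\<^sup>+l. g l \<partial>M) = (\<Sum>i. \<Sum>j\<in>UNIV. ennreal ((norm (block x i $ j))\<^sup>2) * g (m i j))"
    if [measurable]: "g \<in> borel_measurable borel" for g
  proof -
    have "(\<integral>\<^sup>+l. g l \<partial>M) = (\<integral>\<^sup>+p. (case p of (i, j) \<Rightarrow> ennreal ((norm (block x i $ j))\<^sup>2)) *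
        g (case p of (i, j) \<Rightarrow> m i j) \<partial>count_space UNIV)"
      unfolding M_def by (subst nn_integral_distr; (subst nn_integral_density)?) simp_all
    also have "\<dots> = (\<Sum>i. \<Sum>j\<in>UNIV. ennreal ((norm (block x i $ j))\<^sup>2) * g (m i j))"
      by (subst nn_integral_fst_count_space [symmetric])
        (simp add: nn_integral_count_space_nat nn_integral_count_space_finite)
    finally show ?thesis .
  qed
  have "scalar_measure (diag_pvm m) x = M"
  proof (rule measure_eqI)
    show "sets (scalar_measure (diag_pvm m) x) = sets M"
      by (simp add: sets_scalar_measure [OF pvm_diag] M_def)
    fix S assume "S \<in> sets (scalar_measure (diag_pvm m) x)"
    then have S: "S \<in> sets borel" "S \<in> sets M"
      by (simp_all add: sets_scalar_measure [OF pvm_diag] M_def)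
    have "(\<Sum>j\<in>UNIV. ennreal ((norm (block x i $ j))\<^sup>2) * indicator S (m i j)) =
        ennreal ((norm (block (diag_pvm m S x) i))\<^sup>2)" for i
      by (cases "m i 1 \<in> S"; cases "m i 2 \<in> S")
        (simp_all add: sum_2 norm_vec2_power2 block_diag_pvm ennreal_plus)
    moreover have "emeasure M S = (\<Sum>i. \<Sum>j\<in>UNIV. ennreal ((norm (block x i $ j))\<^sup>2) * indicator S (m i j))"
      using M [of "indicator S"] S by simp
    ultimately have "emeasure M S = (\<Sum>i. ennreal ((norm (block (diag_pvm m S x) i))\<^sup>2))"
      by presburger
    also have "\<dots> = ennreal ((norm (diag_pvm m S x))\<^sup>2)"
      by (rule suminf_ennreal_eq) (simp_all add: norm_hsum_sums)
    finally show "emeasure (scalar_measure (diag_pvm m) x) S = emeasure M S"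
      using S by (simp add: emeasure_scalar_measure [OF pvm_diag])
  qed
  then show ?thesis
    by (simp add: M)
qed

text \<open>The growth condition on \<open>g\<close> makes the series comparable with the squared
  graph norm. It is met by the positive and negative parts of l.\<close>

lemma summable_diag_pvm:
  assumes "x \<in> rdiag_dom m" "\<And>l. 0 \<le> g l" "\<And>l. g l \<le> 1 + l\<^sup>2"
  shows "summable (\<lambda>i. \<Sum>j\<in>UNIV. (norm (block x i $ j))\<^sup>2 * g (m i j))"
proof (rule summable_comparison_test)
  show "summable (\<lambda>i. (norm (block x i))\<^sup>2 + (norm (block (rdiag m x) i))\<^sup>2)"
    by (intro summable_add summable_block)
  have "(\<Sum>j\<in>UNIV. (norm (block x i $ j))\<^sup>2 * g (m i j)) \<le>
      (\<Sum>j\<in>UNIV. (norm (block x i $ j))\<^sup>2 * (1 + (m i j)\<^sup>2))" for i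
    by (intro sum_mono mult_left_mono assms) simp
  also have "(\<Sum>j\<in>UNIV. (norm (block x i $ j))\<^sup>2 * (1 + (m i j)\<^sup>2)) =
      (norm (block x i))\<^sup>2 + (norm (block (rdiag m x) i))\<^sup>2" for i
    by (simp add: sum_2 norm_vec2_power2 block_diag assms norm_mult power_mult_distrib algebra_simps)
  finally show "\<exists>N. \<forall>i\<ge>N. norm (\<Sum>j\<in>UNIV. (norm (block x i $ j))\<^sup>2 * g (m i j)) \<le>
      (norm (block x i))\<^sup>2 + (norm (block (rdiag m x) i))\<^sup>2"
    using assms by (simp add: sum_nonneg)
qed

lemma enn2real_nn_integral_diag_pvm:
  assumes "x \<in> rdiag_dom m" "\<And>l. 0 \<le> g l" "\<And>l. g l \<le> 1 + l\<^sup>2" "g \<in> borel_measurable borel"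
  shows "enn2real (\<integral>\<^sup>+l. ennreal (g l) \<partial>scalar_measure (diag_pvm m) x) =
    (\<Sum>i. \<Sum>j\<in>UNIV. (norm (block x i $ j))\<^sup>2 * g (m i j))"
proof -
  have "(\<integral>\<^sup>+l. ennreal (g l) \<partial>scalar_measure (diag_pvm m) x) =
      (\<Sum>i. ennreal (\<Sum>j\<in>UNIV. (norm (block x i $ j))\<^sup>2 * g (m i j)))"
    using assms by (subst nn_integral_diag_pvm) (simp_all add: sum_2 ennreal_plus ennreal_mult)
  also have "\<dots> = ennreal (\<Sum>i. \<Sum>j\<in>UNIV. (norm (block x i $ j))\<^sup>2 * g (m i j))"
    using assms by (intro suminf_ennreal2 summable_diag_pvm sum_nonneg) auto
  finally show ?thesis
    using assms by (simp add: enn2real_ennreal suminf_nonneg summable_diag_pvm sum_nonneg)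
qed

lemma spectral_measure_diag: "spectral_measure_of (rdiag_dom m) (rdiag m) (diag_pvm m)"
  unfolding spectral_measure_of_def
proof (intro conjI ballI)
  show dom: "rdiag_dom m = {x. (\<integral>\<^sup>+l. ennreal (l\<^sup>2) \<partial>scalar_measure (diag_pvm m) x) < \<infinity>}"
    unfolding diag_dom_def
  proof (rule Collect_cong)
    fix x
    let ?a = "\<lambda>i. (norm (\<chi> j. complex_of_real (m i j) * block x i $ j))\<^sup>2"
    have "(\<integral>\<^sup>+l. ennreal (l\<^sup>2) \<partial>scalar_measure (diag_pvm m) x) = (\<Sum>i. ennreal (?a i))"
      by (subst nn_integral_diag_pvm)
        (simp_all add: sum_2 norm_vec2_power2 norm_mult power_mult_distrib mult.commute
          ennreal_plus flip: ennreal_mult)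
    moreover have "(\<Sum>i. ennreal (?a i)) < \<infinity>" if "summable ?a"
      using that by (simp add: suminf_ennreal2)
    moreover have "summable ?a" if "(\<Sum>i. ennreal (?a i)) < \<infinity>"
      using that by (intro summable_suminf_not_top) auto
    ultimately show "summable ?a \<longleftrightarrow> (\<integral>\<^sup>+l. ennreal (l\<^sup>2) \<partial>scalar_measure (diag_pvm m) x) < \<infinity>"
      by auto
  qed
  show "projection_valued_measure (diag_pvm m)"
    by (rule pvm_diag)
  fix x assume x: "x \<in> rdiag_dom m"
  have le: "\<bar>l\<bar> \<le> 1 + l\<^sup>2" for l :: real
    using sum_squares_bound [of 1 "\<bar>l\<bar>"] by simp
  have parts: "inner z (of_real r * z) = (norm z)\<^sup>2 * max 0 r - (norm z)\<^sup>2 * max 0 (- r)"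
    for z :: complex and r
    unfolding cmod_power2 by (simp add: inner_complex_def max_def power2_eq_square algebra_simps)
  \<comment> \<open>The series formula is available for nonnegative integrands, so positive and
    negative parts are summed separately and recombined block by block.\<close>
  have "(\<integral>l. l \<partial>scalar_measure (diag_pvm m) x) =
      enn2real (\<integral>\<^sup>+l. ennreal (max 0 l) \<partial>scalar_measure (diag_pvm m) x) -
      enn2real (\<integral>\<^sup>+l. ennreal (max 0 (- l)) \<partial>scalar_measure (diag_pvm m) x)"
    using x unfolding dom
    by (subst real_lebesgue_integral_def)
      (simp_all add: integrable_scalar_measure [OF pvm_diag] ennreal_max_0)
  also have "\<dots> = (\<Sum>i. \<Sum>j\<in>UNIV. (norm (block x i $ j))\<^sup>2 * max 0 (m i j)) -
      (\<Sum>i. \<Sum>j\<in>UNIV. (norm (block x i $ j))\<^sup>2 * max 0 (- m i j))"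
    using x order_trans [OF _ le]
    by (subst (1 2) enn2real_nn_integral_diag_pvm) (auto simp: max_def)
  also have "\<dots> = (\<Sum>i. (\<Sum>j\<in>UNIV. (norm (block x i $ j))\<^sup>2 * max 0 (m i j)) -
      (\<Sum>j\<in>UNIV. (norm (block x i $ j))\<^sup>2 * max 0 (- m i j)))"
    using x order_trans [OF _ le]
    by (intro suminf_diff summable_diag_pvm) (auto simp: max_def)
  also have "\<dots> = (\<Sum>i. inner (block x i) (block (rdiag m x) i))"
    by (simp add: sum_2 inner_vec_def block_diag x parts algebra_simps)
  finally have int: "(\<integral>l. l \<partial>scalar_measure (diag_pvm m) x) = inner x (rdiag m x)"
    by (simp add: inner_hsum.rep_eq)
  \<comment> \<open>The form has no imaginary part because the multiplier is real.\<close>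
  have "inner (\<i> *\<^sub>C x) (rdiag m x) = (\<Sum>i. 0)"
    unfolding inner_hsum.rep_eq
    by (rule arg_cong [where f = suminf])
      (simp add: fun_eq_iff inner_vec_def block_diag x inner_complex_def block_simps algebra_simps)
  then show "cinner x (rdiag m x) = complex_of_real (\<integral>l. l \<partial>scalar_measure (diag_pvm m) x)"
    by (simp add: cinner_eq_inner int)
qed

subsection \<open>Operator sums and vector derivatives\<close>

lemma clinear_on_plus:
  assumes "clinear_on W A" "clinear_on W B"
  shows "clinear_on W (\<lambda>x. A x + B x)"
proof -
  have "c *\<^sub>C (u + v) = c *\<^sub>C u + c *\<^sub>C v" for c u v
    by (rule hsum_eqI) (simp add: block_simps distrib_left)
  then show ?thesis
    using assms by (simp add: clinear_on_def)
qed

lemma clinear_on_scaleR: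
  assumes "clinear_on W A"
  shows "clinear_on W (\<lambda>x. r *\<^sub>R A x)"
proof -
  have "c *\<^sub>C r *\<^sub>R u = r *\<^sub>R c *\<^sub>C u" for c u
    by (rule hsum_eqI) (simp add: block_simps)
  then show ?thesis
    using assms by (simp add: clinear_on_def scaleR_add_right)
qed

lemma clinear_on_compose_swap:
  assumes "clinear_on W A" "clinear_on W' A'" "\<And>x. x \<in> W' \<Longrightarrow> swap x \<in> W"
  shows "clinear_on W' (\<lambda>x. A (swap x))"
  using assms by (simp add: clinear_on_def swap_linear)

lemma clinear_on_subset:
  assumes "clinear_on W' B" "clinear_on W A" "W \<subseteq> W'"
  shows "clinear_on W B"
  using assms unfolding clinear_on_def by blast

lemma bounded_op_on_graph_normI:
  assumes "clinear_on W F" "\<And>x. x \<in> W \<Longrightarrow> norm (F x) \<le> a * norm x + b * norm (A x)"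
  shows "bounded_op_on W (graph_norm A) F"
  unfolding bounded_op_on_def
proof (intro conjI exI ballI)
  fix x assume "x \<in> W"
  have "norm x \<le> graph_norm A x" "norm (A x) \<le> graph_norm A x"
    by (simp_all add: graph_norm_def real_le_rsqrt)
  then have "a * norm x + b * norm (A x) \<le> \<bar>a\<bar> * graph_norm A x + \<bar>b\<bar> * graph_norm A x"
    by (intro add_mono mult_mono) auto
  then show "norm (F x) \<le> (\<bar>a\<bar> + \<bar>b\<bar>) * graph_norm A x"
    using assms(2) [OF \<open>x \<in> W\<close>] by (simp add: distrib_right)
qed (rule assms)

text \<open>The quotient form reduces derivatives to limits, where dominated convergence and
  coordinatewise arguments apply.\<close>

lemma has_vector_derivative_iff_quotient:
  "(f has_vector_derivative f') (at t within X) \<longleftrightarrow>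
    ((\<lambda>s. (f s - f t) /\<^sub>R (s - t)) \<longlongrightarrow> f') (at t within X)"
proof -
  have "norm (f s - f t - (s - t) *\<^sub>R f') / norm (s - t) = norm ((f s - f t) /\<^sub>R (s - t) - f')"
    if "s \<noteq> t" for s
  proof -
    have "(f s - f t) /\<^sub>R (s - t) - f' = (f s - f t - (s - t) *\<^sub>R f') /\<^sub>R (s - t)"
      using that by (simp add: scaleR_diff_right)
    then show ?thesis
      by (simp add: divide_inverse mult.commute)
  qed
  then have "((\<lambda>s. norm (f s - f t - (s - t) *\<^sub>R f') / norm (s - t)) \<longlongrightarrow> 0) (at t within X) \<longleftrightarrow>
      ((\<lambda>s. norm ((f s - f t) /\<^sub>R (s - t) - f')) \<longlongrightarrow> 0) (at t within X)"
    by (intro filterlim_cong refl) (simp add: eventually_at_filter)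
  also have "\<dots> \<longleftrightarrow> ((\<lambda>s. (f s - f t) /\<^sub>R (s - t)) \<longlongrightarrow> f') (at t within X)"
    by (simp add: tendsto_norm_zero_iff LIM_zero_iff)
  finally show ?thesis
    by (simp add: has_vector_derivative_def has_derivative_iff_norm bounded_linear_scaleR_left)
qed

lemma has_vector_derivative_cis:
  "((\<lambda>t. cis (a * t)) has_vector_derivative \<i> * of_real a * cis (a * t)) (at t within X)"
proof -
  have "((\<lambda>z. exp (\<i> * (of_real a * z))) has_field_derivative
      \<i> * of_real a * exp (\<i> * (of_real a * of_real t))) (at (of_real t))"
    by (auto intro!: derivative_eq_intros)
  from has_vector_derivative_real_field [OF this] show ?thesis
    by (simp add: cis_conv_exp)
qed

text \<open>A chord is at most as long as its arc. This yields the majorant for the difference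
  quotients of the phases.\<close>

lemma norm_cis_diff_le: "norm (cis a - cis b) \<le> \<bar>a - b\<bar>"
proof -
  have "cis a - cis b = cis b * (cis (a - b) - 1)"
    by (simp add: right_diff_distrib cis_mult)
  then have "norm (cis a - cis b) = norm (cis (a - b) - 1)"
    by (simp add: norm_mult)
  also have "\<dots> = 2 * \<bar>sin ((a - b) / 2)\<bar>"
    unfolding cis_conv_exp by (rule dist_exp_i_1)
  also have "\<dots> \<le> \<bar>a - b\<bar>"
    using abs_sin_x_le_abs_x [of "(a - b) / 2"] by simp
  finally show ?thesis .
qed


subsection \<open>The perturbed family\<close>

definition eig :: "(nat \<Rightarrow> real) \<Rightarrow> nat \<Rightarrow> 2 \<Rightarrow> real" where
  "eig lam i j = (if j = 1 then - lam i else lam i)"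

lemma eig_simps [simp]: "eig lam i 1 = - lam i" "eig lam i 2 = lam i"
  by (simp_all add: eig_def)

lemma abs_eig: "\<bar>eig lam i j\<bar> = \<bar>lam i\<bar>"
  by (simp add: eig_def)

lemma a_matrix_mult: "a_matrix (lam i) *v v = (\<chi> j. of_real (eig lam i j) * v $ j)"
  by (simp add: vec_eq_iff forall_2 a_matrix_def matrix_vector_mult_def sum_2)

lemma A0_domain_eq: "A0_domain lam = rdiag_dom (eig lam)"
  by (simp add: A0_domain_def diag_dom_def a_matrix_mult)

lemma A0_eq: "A0 lam = rdiag (eig lam)"
  by (simp add: fun_eq_iff A0_def diag_def a_matrix_mult)

text \<open>The sign in \<open>eig\<close> makes the two entries of a block conjugate, so that
  multiplication after the swap is a Hermitian off-diagonal matrix.\<close>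

definition phase :: "(nat \<Rightarrow> real) \<Rightarrow> real \<Rightarrow> nat \<Rightarrow> 2 \<Rightarrow> complex" where
  "phase lam t i j = cis (2 * eig lam i j * t)"

definition dphase :: "(nat \<Rightarrow> real) \<Rightarrow> real \<Rightarrow> nat \<Rightarrow> 2 \<Rightarrow> complex" where
  "dphase lam t i j = \<i> * of_real (2 * eig lam i j) * cis (2 * eig lam i j * t)"

lemma norm_phase: "norm (phase lam t i j) = 1" "norm (dphase lam t i j) = 2 * \<bar>lam i\<bar>"
  by (simp_all add: phase_def dphase_def norm_mult abs_eig)

lemma phase_dom: "x \<in> diag_dom (phase lam t)"
  by (rule diag_dom_bounded [where K = 1]) (simp add: norm_phase)

lemma dphase_dom: "x \<in> A0_domain lam \<Longrightarrow> x \<in> diag_dom (dphase lam t)"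
  unfolding A0_domain_eq by (rule diag_dom_mono [where K = 2]) (assumption, simp add: norm_phase abs_eig)

text \<open>Difference quotient and derivative of the phase are both at most 2 \<open>lam i\<close>
  in modulus. Their difference is dominated by 4 \<open>lam i\<close>, an admissible multiplier for
  \<open>x\<close> in the domain of \<open>A0 lam\<close>.\<close>

lemma has_vector_derivative_diag_phase:
  assumes "x \<in> A0_domain lam"
  shows "((\<lambda>t. diag (phase lam t) x) has_vector_derivative diag (dphase lam t) x) (at t within X)"
proof -
  define q where "q s i j = (phase lam s i j - phase lam t i j) /\<^sub>R (s - t)" for s i j
  \<comment> \<open>At s = t the quotient is 0 by the convention for division by zero, so the bound
    holds for all s.\<close>
  have q: "norm (q s i j) \<le> 2 * \<bar>lam i\<bar>" for s i j
  proof (cases "s = t")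
    case False
    have "norm (phase lam s i j - phase lam t i j) \<le> \<bar>2 * eig lam i j * s - 2 * eig lam i j * t\<bar>"
      unfolding phase_def by (rule norm_cis_diff_le)
    also have "\<dots> = 2 * \<bar>lam i\<bar> * \<bar>s - t\<bar>"
      unfolding right_diff_distrib [symmetric] by (simp add: abs_mult abs_eig)
    finally have "norm (phase lam s i j - phase lam t i j) / \<bar>s - t\<bar> \<le> 2 * \<bar>lam i\<bar>"
      using False by (simp add: pos_divide_le_eq)
    then show ?thesis
      by (simp add: q_def divide_inverse mult.commute)
  qed (simp add: q_def)
  have q_dom: "x \<in> diag_dom (q s)" for s
    using assms unfolding A0_domain_eq
    by (rule diag_dom_mono [where K = 2]) (simp add: q abs_eig)
  have "(\<lambda>s. (diag (phase lam s) x - diag (phase lam t) x) /\<^sub>R (s - t)) = (\<lambda>s. diag (q s) x)"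
    by (intro ext hsum_eqI)
      (simp add: block_simps block_diag phase_dom q_dom q_def flip: left_diff_distrib)
  moreover have "((\<lambda>s. diag (q s) x) \<longlongrightarrow> diag (dphase lam t) x) (at t within X)"
  proof (rule tendsto_diag [OF q_dom dphase_dom])
    show "x \<in> diag_dom (\<lambda>i j. of_real (4 * eig lam i j))"
      using assms unfolding A0_domain_eq
      by (rule diag_dom_mono [where K = 4]) (simp add: norm_mult)
    have "norm (q s i j - dphase lam t i j) \<le> norm (complex_of_real (4 * eig lam i j))" for s i j
      using norm_triangle_ineq4 [of "q s i j" "dphase lam t i j"] q [of s i j]
      by (simp add: norm_phase norm_mult abs_eig)
    then show "\<forall>\<^sub>F s in at t within X. \<forall>i j. norm (q s i j - dphase lam t i j) \<le>
        norm (complex_of_real (4 * eig lam i j))"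
      by simp
    show "((\<lambda>s. q s i j) \<longlongrightarrow> dphase lam t i j) (at t within X)" for i j
      using has_vector_derivative_cis [of "2 * eig lam i j" t X]
      unfolding q_def phase_def dphase_def has_vector_derivative_iff_quotient .
  qed (use assms in simp)
  ultimately show ?thesis
    unfolding has_vector_derivative_iff_quotient by simp
qed

lemma continuous_on_diag_dphase:
  assumes "x \<in> A0_domain lam"
  shows "continuous_on X (\<lambda>t. diag (dphase lam t) x)"
  unfolding continuous_on_def
proof
  fix t
  show "((\<lambda>s. diag (dphase lam s) x) \<longlongrightarrow> diag (dphase lam t) x) (at t within X)"
  proof (rule tendsto_diag [OF dphase_dom [OF assms] dphase_dom [OF assms]])
    show "x \<in> diag_dom (\<lambda>i j. of_real (4 * eig lam i j))"
      using assms unfolding A0_domain_eq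
      by (rule diag_dom_mono [where K = 4]) (simp add: norm_mult)
    have "norm (dphase lam s i j - dphase lam t i j) \<le> norm (complex_of_real (4 * eig lam i j))"
      for s i j
      using norm_triangle_ineq4 [of "dphase lam s i j" "dphase lam t i j"]
      by (simp add: norm_phase norm_mult abs_eig)
    then show "\<forall>\<^sub>F s in at t within X. \<forall>i j. norm (dphase lam s i j - dphase lam t i j) \<le>
        norm (complex_of_real (4 * eig lam i j))"
      by simp
    show "((\<lambda>s. dphase lam s i j) \<longlongrightarrow> dphase lam t i j) (at t within X)" for i j
      unfolding dphase_def by (intro tendsto_intros)
  qed
qed

text \<open>Both eigenvalues of a block have the same modulus.\<close>

lemma swap_A0_domain: "x \<in> A0_domain lam \<Longrightarrow> swap x \<in> A0_domain lam"
  unfolding A0_domain_eq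
proof (rule diag_domI [where y = "swap (rdiag (eig lam) x)"])
  show "norm (of_real (eig lam i j) * block (swap x) i $ j) \<le>
      norm (block (swap (rdiag (eig lam) x)) i $ j)"
    if "x \<in> rdiag_dom (eig lam)" for i j
    by (simp add: swap.rep_eq block_diag that norm_mult abs_eig)
qed

text \<open>The \<phi> of the overview. The sine integrates to \<open>2 * T / pi\<close> over
  [0, T], so this amplitude gives the total angle \<open>pi / 2\<close>.\<close>

definition angle_rate :: "real \<Rightarrow> real \<Rightarrow> real" where
  "angle_rate T t = pi\<^sup>2 / (4 * T) * sin (pi * t / T)"

definition rot :: "(nat \<Rightarrow> real) \<Rightarrow> real \<Rightarrow> hsum \<Rightarrow> hsum" where
  "rot lam t x = diag (phase lam t) (swap x)"

definition pert :: "(nat \<Rightarrow> real) \<Rightarrow> real \<Rightarrow> real \<Rightarrow> hsum \<Rightarrow> hsum" where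
  "pert lam T t x = angle_rate T t *\<^sub>R rot lam t x"

definition fam :: "(nat \<Rightarrow> real) \<Rightarrow> real \<Rightarrow> real \<Rightarrow> hsum \<Rightarrow> hsum" where
  "fam lam T t x = A0 lam x + pert lam T t x"

lemma norm_rot_le: "norm (rot lam t x) \<le> norm x"
  using norm_diag_le [of "swap x" "\<lambda>_ _. 1" "phase lam t" 1]
  by (simp add: rot_def norm_phase phase_dom diag_one norm_swap diag_dom_bounded [where K = 1])

lemma block_rot:
  "block (rot lam t x) i $ 1 = cis (- (2 * lam i * t)) * block x i $ 2"
  "block (rot lam t x) i $ 2 = cis (2 * lam i * t) * block x i $ 1"
  by (simp_all add: rot_def block_diag phase_dom phase_def)

lemma clinear_on_A0: "clinear_on (A0_domain lam) (A0 lam)"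
  unfolding A0_domain_eq A0_eq by (rule clinear_on_diag)

lemma clinear_on_rot: "clinear_on UNIV (rot lam t)"
proof -
  have "clinear_on UNIV (diag (phase lam t))"
    by (rule clinear_on_diag_UNIV [where K = 1]) (simp add: norm_phase)
  then show ?thesis
    unfolding rot_def [abs_def] by (intro clinear_on_compose_swap) auto
qed

lemma angle_rate_ends: "angle_rate T 0 = 0" "angle_rate T T = 0"
  by (simp_all add: angle_rate_def)

text \<open>Both boundary conditions thus refer to the spectral projections of
  \<open>A0 lam\<close>, and the norm of W is the graph norm of \<open>A0 lam\<close>.\<close>

lemma fam_ends: "fam lam T 0 = A0 lam" "fam lam T T = A0 lam"
  by (simp_all add: fun_eq_iff fam_def pert_def angle_rate_ends)

lemma clinear_on_pert: "clinear_on UNIV (pert lam T t)"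
  unfolding pert_def [abs_def] by (intro clinear_on_scaleR clinear_on_rot)

lemma norm_pert_le: "norm (pert lam T t x) \<le> \<bar>angle_rate T t\<bar> * norm x"
  by (simp add: pert_def mult_left_mono norm_rot_le)

lemma clinear_on_fam: "clinear_on (A0_domain lam) (fam lam T t)"
  unfolding fam_def [abs_def]
  by (intro clinear_on_plus clinear_on_A0 clinear_on_subset [OF clinear_on_pert clinear_on_A0]) simp

lemma abs_angle_rate_le:
  assumes "0 < T"
  shows "\<bar>angle_rate T t\<bar> \<le> pi\<^sup>2 / (4 * T)"
proof -
  have "\<bar>angle_rate T t\<bar> = pi\<^sup>2 / (4 * T) * \<bar>sin (pi * t / T)\<bar>"
    using assms by (simp add: angle_rate_def abs_mult)
  also have "\<dots> \<le> pi\<^sup>2 / (4 * T) * 1"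
    using assms by (intro mult_left_mono) auto
  finally show ?thesis by simp
qed

lemma strongly_C1_fam:
  assumes "0 < T"
  shows "strongly_C1 T (A0_domain lam) (fam lam T)"
proof -
  define rate' where "rate' t = pi\<^sup>2 / (4 * T) * (cos (pi * t / T) * (pi / T))" for t
  \<comment> \<open>Product rule. The first term is bounded only relative to \<open>A0 lam\<close>,
    by twice \<open>norm (A0 lam x)\<close> up to the rate; the second is bounded on the whole
    space.\<close>
  define A' where "A' t x = angle_rate T t *\<^sub>R diag (dphase lam t) (swap x) + rate' t *\<^sub>R rot lam t x"
    for t x
  have rate: "(angle_rate T has_field_derivative rate' t) (at t within X)" for t X
    unfolding angle_rate_def [abs_def] rate'_def
    using assms by (auto intro!: derivative_eq_intros simp: mult_ac)
  have dphase: "norm (diag (dphase lam t) (swap x)) \<le> 2 * norm (A0 lam x)"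
    if "x \<in> A0_domain lam" for t x
  proof -
    have "norm (diag (dphase lam t) (swap x)) \<le> 2 * norm (swap (A0 lam x))"
      using that dphase_dom [OF swap_A0_domain [OF that]] unfolding A0_domain_eq A0_eq
      by (intro norm_le_if_block_le norm_vec2_mult_le)
        (simp_all add: block_diag norm_mult norm_phase swap.rep_eq abs_eig)
    then show ?thesis
      by (simp add: norm_swap)
  qed
  have "bounded_op_on (A0_domain lam) (graph_norm (A0 lam)) (fam lam T t)" for t
  proof (rule bounded_op_on_graph_normI [OF clinear_on_fam])
    show "norm (fam lam T t x) \<le> \<bar>angle_rate T t\<bar> * norm x + 1 * norm (A0 lam x)" for x
      using norm_triangle_ineq [of "A0 lam x" "pert lam T t x"] norm_pert_le [of lam T t x]
      by (simp add: fam_def)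
  qed
  moreover have "bounded_op_on (A0_domain lam) (graph_norm (A0 lam)) (A' t)" for t
  proof (rule bounded_op_on_graph_normI)
    show "clinear_on (A0_domain lam) (A' t)"
      unfolding A'_def [abs_def]
      by (intro clinear_on_plus clinear_on_scaleR clinear_on_compose_swap [OF clinear_on_diag clinear_on_A0]
          clinear_on_subset [OF clinear_on_rot clinear_on_A0] dphase_dom swap_A0_domain) auto
    fix x assume x: "x \<in> A0_domain lam"
    have "norm (A' t x) \<le> \<bar>angle_rate T t\<bar> * norm (diag (dphase lam t) (swap x)) +
        \<bar>rate' t\<bar> * norm (rot lam t x)"
      unfolding A'_def by (rule norm_triangle_le) simp
    also have "\<dots> \<le> \<bar>angle_rate T t\<bar> * (2 * norm (A0 lam x)) + \<bar>rate' t\<bar> * norm x"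
      by (intro add_mono mult_left_mono dphase x norm_rot_le) auto
    finally show "norm (A' t x) \<le> \<bar>rate' t\<bar> * norm x + (2 * \<bar>angle_rate T t\<bar>) * norm (A0 lam x)"
      by (simp add: mult_ac)
  qed
  moreover have "((\<lambda>s. fam lam T s x) has_vector_derivative A' t x) (at t within {0..T})"
    if "x \<in> A0_domain lam" for t x
  proof -
    have "((\<lambda>s. A0 lam x + pert lam T s x) has_vector_derivative 0 + A' t x) (at t within {0..T})"
      unfolding pert_def rot_def A'_def
      by (intro has_vector_derivative_add has_vector_derivative_const has_vector_derivative_scaleR
          rate has_vector_derivative_diag_phase swap_A0_domain that)
    then show ?thesis
      by (simp add: fam_def)
  qed
  moreover have "continuous_on {0..T} (\<lambda>t. A' t x)" if x: "x \<in> A0_domain lam" for x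
  proof -
    have "continuous_on {0..T} (\<lambda>t. rot lam t x)"
      unfolding rot_def
      by (rule continuous_on_vector_derivative [OF has_vector_derivative_diag_phase])
        (simp add: x swap_A0_domain)
    then show ?thesis
      unfolding A'_def angle_rate_def rate'_def
      using assms by (intro continuous_intros continuous_on_diag_dphase swap_A0_domain x) auto
  qed
  ultimately show ?thesis
    unfolding strongly_C1_def fam_ends by blast
qed

section \<open>Self-adjointness and invertibility of the operators A(t)\<close>

context
  fixes lam :: "nat \<Rightarrow> real"
  assumes pos: "\<And>i. 0 < lam i" and inc: "incseq lam"
begin

lemma closure_A0_domain: "closure (A0_domain lam) = UNIV"
proof -
  have "x \<in> closure (A0_domain lam)" for x
  proof -
    \<comment> \<open>Cutting off to the first n blocks lands in the domain: by monotonicity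
      \<open>lam n\<close> bounds the remaining eigenvalues.\<close>
    define c :: "nat \<Rightarrow> nat \<Rightarrow> 2 \<Rightarrow> complex" where "c n i j = (if i < n then 1 else 0)" for n i j
    have dom: "x \<in> diag_dom (c n)" for n
      by (rule diag_dom_bounded [where K = 1]) (simp add: c_def)
    have "(\<lambda>n. diag (c n) x) \<longlonglongrightarrow> diag (\<lambda>_ _. 1) x"
    proof (rule tendsto_diag [OF dom])
      show "(\<lambda>n. c n i j) \<longlonglongrightarrow> 1" for i j
        by (rule tendsto_eventually) (auto simp: c_def eventually_sequentially intro!: exI [of _ "Suc i"])
      show "\<forall>\<^sub>F n in sequentially. \<forall>i j. norm (c n i j - 1) \<le> norm (1 :: complex)"
        by (simp add: c_def)
    qed (rule diag_dom_bounded [where K = 1], simp)+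
    moreover have "diag (c n) x \<in> A0_domain lam" for n
      unfolding A0_domain_eq
    proof (rule diag_dom_diag [OF dom, where K = "lam n"])
      show "norm (of_real (eig lam i j) * c n i j) \<le> lam n" for i j
        using incseqD [OF inc, of i n] pos [of i] pos [of n]
        by (simp add: c_def norm_mult abs_eig)
    qed
    ultimately show ?thesis
      unfolding closure_sequential by (metis diag_one)
  qed
  then show ?thesis by blast
qed

lemma block_fam:
  assumes "x \<in> A0_domain lam"
  shows "block (fam lam T t x) i $ 1 =
      - lam i * block x i $ 1 + angle_rate T t * (cis (- (2 * lam i * t)) * block x i $ 2)"
    and "block (fam lam T t x) i $ 2 =
      lam i * block x i $ 2 + angle_rate T t * (cis (2 * lam i * t) * block x i $ 1)"
  using assms unfolding A0_domain_eq
  by (simp_all add: fam_def pert_def A0_eq plus_hsum.rep_eq block_diag block_rot block_scaleR)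

lemma cinner_fam_sym:
  assumes "x \<in> A0_domain lam" "y \<in> A0_domain lam"
  shows "cinner (fam lam T t x) y = cinner x (fam lam T t y)"
  by (simp add: cinner_def sum_2 block_fam assms cis_cnj algebra_simps)

text \<open>Blockwise \<open>A(t)\<^sup>2\<close> is the scalar \<open>\<lambda>\<^sub>i\<^sup>2 + \<phi>(t)\<^sup>2\<close> with \<open>\<phi> = angle_rate T\<close>, so \<open>A(t)\<close> divided by it is a bounded inverse.\<close>

lemma fam_surj:
  obtains x where "x \<in> A0_domain lam" "fam lam T t x = z"
proof -
  define d where "d i = (lam i)\<^sup>2 + (angle_rate T t)\<^sup>2" for i
  have d_pos: "0 < d i" for i
    using pos [of i] by (simp add: d_def add_pos_nonneg)
  have lam_le: "lam i * lam i \<le> d i" for i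
    by (simp add: d_def power2_eq_square)
  have lam0: "lam 0 * lam i \<le> d i" for i
    using incseqD [OF inc, of 0 i] pos [of 0] pos [of i] lam_le [of i]
    by (meson le0 less_imp_le mult_right_mono order_trans)
  \<comment> \<open>Monotonicity makes \<open>lam 0\<close> a positive lower bound for all
    \<open>lam i\<close>, so the inverse is bounded uniformly in the blocks.\<close>
  have b: "lam i / d i \<le> 1 / lam 0" "1 / d i \<le> 1 / (lam 0)\<^sup>2" for i
  proof -
    show "lam i / d i \<le> 1 / lam 0"
      using lam0 [of i] d_pos [of i] pos [of 0] by (simp add: field_simps)
    have "(lam 0)\<^sup>2 \<le> d i"
      using lam0 [of i] incseqD [OF inc, of 0 i] pos [of 0]
      by (metis le0 less_imp_le mult_left_mono order_trans power2_eq_square)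
    then show "1 / d i \<le> 1 / (lam 0)\<^sup>2"
      using pos [of 0] by (intro divide_left_mono) (auto simp: d_pos)
  qed
  \<comment> \<open>The preimage of \<open>z\<close> is A(t) z divided blockwise by
    \<open>d\<close>: \<open>p\<close> comes from the diagonal part and \<open>q\<close>, weighted
    by \<open>angle_rate T t\<close>, from the coupling. The mixed terms cancel because the two
    parts anticommute.\<close>
  define p where "p = rdiag (\<lambda>i j. eig lam i j / d i) z"
  define q where "q = rdiag (\<lambda>i j. 1 / d i) (rot lam t z)"
  have p_dom: "z \<in> rdiag_dom (\<lambda>i j. eig lam i j / d i)"
    by (rule diag_dom_bounded [where K = "1 / lam 0"])
      (use b pos d_pos in \<open>simp add: abs_eig norm_divide abs_of_pos\<close>)
  have q_dom: "rot lam t z \<in> rdiag_dom (\<lambda>i j. 1 / d i)"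
    by (rule diag_dom_bounded [where K = "1 / (lam 0)\<^sup>2"])
      (use b d_pos in \<open>simp add: norm_divide abs_of_pos\<close>)
  have "p \<in> A0_domain lam"
    unfolding A0_domain_eq p_def
    by (rule diag_dom_diag [OF p_dom, where K = 1])
      (use lam_le pos d_pos in \<open>simp add: norm_mult norm_divide abs_eig abs_of_pos\<close>)
  moreover have "q \<in> A0_domain lam"
    unfolding A0_domain_eq q_def
    by (rule diag_dom_diag [OF q_dom, where K = "1 / lam 0"])
      (use b pos d_pos in \<open>simp add: norm_mult norm_divide abs_eig abs_of_pos\<close>)
  ultimately have x: "p + angle_rate T t *\<^sub>R q \<in> A0_domain lam"
    using clinear_on_A0 [of lam] unfolding clinear_on_def scaleC_of_real [symmetric] by blast
  have "fam lam T t (p + angle_rate T t *\<^sub>R q) = z"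
  proof (rule hsum_eqI)
    fix i and j :: 2
    have pq: "block p i $ 1 = - (lam i / d i) * block z i $ 1" "block p i $ 2 = lam i / d i * block z i $ 2"
      "block q i $ 1 = 1 / d i * (cis (- (2 * lam i * t)) * block z i $ 2)"
      "block q i $ 2 = 1 / d i * (cis (2 * lam i * t) * block z i $ 1)"
      unfolding p_def q_def block_diag [OF p_dom] block_diag [OF q_dom] block_rot by simp_all
    have cis: "cis (- (2 * lam i * t)) * (cis (2 * lam i * t) * w) = w"
      "cis (2 * lam i * t) * (cis (- (2 * lam i * t)) * w) = w" for w
      by (simp_all add: cis_mult flip: mult.assoc)
    have one: "(lam i)\<^sup>2 / d i + (angle_rate T t)\<^sup>2 / d i = 1"
      unfolding add_divide_distrib [symmetric] d_def [symmetric] using d_pos [of i] by simp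
    have dd: "of_real ((lam i)\<^sup>2 / d i) * w + of_real ((angle_rate T t)\<^sup>2 / d i) * w = w" for w :: complex
      unfolding distrib_right [symmetric] of_real_add [symmetric] one by simp
    have "j = 1 \<or> j = 2"
      by (rule exhaust_2)
    then show "block (fam lam T t (p + angle_rate T t *\<^sub>R q)) i $ j = block z i $ j"
      using dd [of "block z i $ 1"] dd [of "block z i $ 2"] cis [of "block z i $ 1"] cis [of "block z i $ 2"]
      by (auto simp: block_fam [OF x] plus_hsum.rep_eq block_scaleR pq algebra_simps power2_eq_square)
  qed
  then show ?thesis
    using x that by blast
qed

text \<open>A densely defined symmetric surjective operator is self-adjoint. For (y, z) in the
  adjoint graph choose w with A(t) w = z; then y and w have the same inner product with every vector
  in the range, which is everything.\<close>

lemma self_adjoint_fam: "self_adjoint (A0_domain lam) (fam lam T t)"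
  unfolding self_adjoint_def
proof (intro conjI clinear_on_fam closure_A0_domain equalityI subsetI)
  fix yz assume yz: "yz \<in> adjoint_graph (A0_domain lam) (fam lam T t)"
  obtain y z where yz_eq: "yz = (y, z)"
    by (cases yz)
  obtain w where w: "w \<in> A0_domain lam" "fam lam T t w = z"
    using fam_surj .
  have "cinner u y = cinner u w" for u
  proof -
    obtain x where x: "x \<in> A0_domain lam" "fam lam T t x = u"
      using fam_surj .
    have "cinner u y = cinner x z"
      using yz x by (auto simp: adjoint_graph_def yz_eq)
    also have "\<dots> = cinner u w"
      using cinner_fam_sym [OF x(1) w(1), of T t] by (simp add: x w)
    finally show ?thesis .
  qed
  then have "y = w"
    by (rule cinner_eqI)
  then show "yz \<in> op_graph (A0_domain lam) (fam lam T t)"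
    using w by (auto simp: op_graph_def yz_eq)
next
  fix yz assume "yz \<in> op_graph (A0_domain lam) (fam lam T t)"
  then show "yz \<in> adjoint_graph (A0_domain lam) (fam lam T t)"
    by (auto simp: op_graph_def adjoint_graph_def cinner_fam_sym)
qed

text \<open>By symmetry the kernel is orthogonal to the range, which is the whole space. Both
  dimensions are 0, and the empty set spans both quotients.\<close>

lemma fredholm_fam: "fredholm scaleC UNIV {0} (op_graph (A0_domain lam) (fam lam T t))"
proof -
  have kernel: "x = 0" if x: "x \<in> A0_domain lam" "fam lam T t x = 0" for x
  proof (rule cinner_eqI)
    fix u
    obtain y where y: "y \<in> A0_domain lam" "fam lam T t y = u"
      using fam_surj .
    have "cinner v 0 = 0" for v
      by (simp add: cinner_def block_simps)
    then show "cinner u x = cinner u 0"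
      using cinner_fam_sym [OF y(1) x(1), of T t] by (simp add: x y)
  qed
  have "{u. \<exists>v\<in>{0}. (u, v) \<in> op_graph (A0_domain lam) (fam lam T t)} \<subseteq> {0}"
    using kernel by (auto simp: op_graph_def)
  moreover have "v \<in> Range (op_graph (A0_domain lam) (fam lam T t))" for v
    using fam_surj [of T t v] unfolding op_graph_def by blast
  ultimately show ?thesis
    unfolding fredholm_def finite_dim_quotient_def by (intro conjI exI [of _ "{}"]) auto
qed

lemma admissible_fam:
  assumes "0 < T"
  shows "admissible_family T (A0_domain lam) (fam lam T)"
  unfolding admissible_family_def
  using self_adjoint_fam fredholm_fam strongly_C1_fam [OF assms] by blast

text \<open>\<open>THE\<close> requires uniqueness. Any spectral measure acts on the coordinate unit
  vectors, which are eigenvectors, in the prescribed way; symmetry of the projection then determines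
  each coordinate of its value at an arbitrary vector.\<close>

lemma spectral_projection_A0:
  assumes "S = {..<0} \<or> S = {0..}"
  shows "spectral_projection (A0_domain lam) (A0 lam) S = diag_pvm (eig lam) S"
  unfolding spectral_projection_def
proof (rule the_equality)
  show "\<exists>E. spectral_measure_of (A0_domain lam) (A0 lam) E \<and> diag_pvm (eig lam) S = E S"
    unfolding A0_domain_eq A0_eq using spectral_measure_diag by blast
  fix P assume "\<exists>E. spectral_measure_of (A0_domain lam) (A0 lam) E \<and> P = E S"
  then obtain E where E: "spectral_measure_of (A0_domain lam) (A0 lam) E" and P: "P = E S"
    by blast
  have sa: "self_adjoint (A0_domain lam) (A0 lam)"
    using self_adjoint_fam [where t = 0] by (simp add: fam_ends)
  show "P = diag_pvm (eig lam) S"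
  proof (rule ext, rule hsum_eqI)
    fix x i and j :: 2
    define e where "e = blk i (axis j 1)"
    have block_e: "block e k $ l = (if k = i \<and> l = j then 1 else 0)" for k l
      by (simp add: e_def blk.rep_eq axis_def)
    have e: "e \<in> A0_domain lam"
      unfolding A0_domain_eq
      by (rule diag_domI [where y = "eig lam i j *\<^sub>R e"]) (simp add: block_simps block_e)
    have Ae: "A0 lam e = eig lam i j *\<^sub>R e"
      using e unfolding A0_eq A0_domain_eq
      by (intro hsum_eqI) (simp add: block_diag block_scaleR block_e)
    note eigenvector = spectral_eigenvector [OF E sa e Ae]
    have "E S e = indicator S (eig lam i j) *\<^sub>R e"
      using assms eigenvector pos [of i] by (cases "j = 1") (auto simp: eig_def)
    moreover have "orthogonal_projection (E S)"
      using assms by (auto intro: pvm_projection [OF spectral_pvm [OF E sa]])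
    ultimately have "block (E S x) i $ j = cinner (indicator S (eig lam i j) *\<^sub>R e) x"
      unfolding orthogonal_projection_def e_def by (metis cinner_blk_axis)
    also have "\<dots> = of_real (indicator S (eig lam i j)) * block x i $ j"
      by (cases "eig lam i j \<in> S")
        (simp_all add: cinner_blk_axis e_def, simp add: cinner_def block_simps)
    finally show "block (P x) i $ j = block (diag_pvm (eig lam) S x) i $ j"
      by (simp add: P block_diag_pvm)
  qed
qed


subsection \<open>The kernel of \<open>D\<^sub>A\<^sub>P\<^sub>S\<close>\<close>

text \<open>The antiderivative of \<open>angle_rate T\<close> vanishing at 0, the \<Phi> of the
  overview; its value at \<open>T\<close> is \<open>pi / 2\<close>.\<close>

definition angle :: "real \<Rightarrow> real \<Rightarrow> real" where
  "angle T t = pi / 4 * (1 - cos (pi * t / T))"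

text \<open>In the rotating frame this is (cos \<Phi>, i sin \<Phi>), the flow applied to the first
  basis vector; the factors \<open>cis\<close> lead back to the original frame.\<close>

definition sol :: "real \<Rightarrow> nat \<Rightarrow> real \<Rightarrow> complex ^ 2" where
  "sol T i t = vector [of_real (cos (angle T t)) * cis (- (lam i * t)),
    \<i> * of_real (sin (angle T t)) * cis (lam i * t)]"

definition dsol :: "real \<Rightarrow> nat \<Rightarrow> real \<Rightarrow> complex ^ 2" where
  "dsol T i t = vector
    [- (of_real (angle_rate T t * sin (angle T t)) + \<i> * of_real (lam i * cos (angle T t))) * cis (- (lam i * t)),
     (\<i> * of_real (angle_rate T t * cos (angle T t)) - of_real (lam i * sin (angle T t))) * cis (lam i * t)]"

lemma norm_sol: "norm (sol T i t) = 1"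
proof (rule power2_eq_imp_eq)
  show "(norm (sol T i t))\<^sup>2 = 1\<^sup>2"
    by (simp add: norm_vec2_power2 sol_def norm_mult)
qed simp_all

lemma has_vector_derivative_sol:
  assumes "0 < T"
  shows "(sol T i has_vector_derivative dsol T i t) (at t within X)"
proof -
  have angle: "(angle T has_field_derivative angle_rate T t) (at t)"
    unfolding angle_def [abs_def] angle_rate_def using assms
    by (auto intro!: derivative_eq_intros simp: power2_eq_square)
  have 1: "((\<lambda>t. sol T i t $ 1) has_vector_derivative dsol T i t $ 1) (at t within X)"
    using has_vector_derivative_at_within [OF has_vector_derivative_scaleR
        [OF DERIV_fun_cos [OF angle] has_vector_derivative_cis [of "- lam i"]]]
    by (simp add: sol_def dsol_def scaleR_conv_of_real algebra_simps)
  have icis: "((\<lambda>t. \<i> * cis (lam i * t)) has_vector_derivative \<i> * (\<i> * of_real (lam i) * cis (lam i * t))) (at t)"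
    by (intro has_vector_derivative_mult_right has_vector_derivative_cis)
  have 2: "((\<lambda>t. sol T i t $ 2) has_vector_derivative dsol T i t $ 2) (at t within X)"
    using has_vector_derivative_at_within [OF has_vector_derivative_scaleR [OF DERIV_fun_sin [OF angle] icis]]
    by (simp add: sol_def dsol_def scaleR_conv_of_real algebra_simps)
  show ?thesis
    unfolding has_vector_derivative_iff_quotient
  proof (rule vec_tendstoI)
    fix j :: 2
    have "j = 1 \<or> j = 2"
      by (rule exhaust_2)
    then show "((\<lambda>s. ((sol T i s - sol T i t) /\<^sub>R (s - t)) $ j) \<longlongrightarrow> dsol T i t $ j) (at t within X)"
      using 1 2 unfolding has_vector_derivative_iff_quotient
      by auto
  qed
qed

lemma continuous_on_dsol:
  assumes "0 < T"
  shows "continuous_on X (dsol T i)"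
proof -
  have comp: "continuous_on X (\<lambda>t. dsol T i t $ 1)" "continuous_on X (\<lambda>t. dsol T i t $ 2)"
    unfolding dsol_def vector_2 angle_rate_def angle_def
    using assms by (auto intro!: continuous_intros)
  show ?thesis
    unfolding continuous_on_def
  proof (intro ballI vec_tendstoI)
    fix t and j :: 2
    assume "t \<in> X"
    moreover have "j = 1 \<or> j = 2"
      by (rule exhaust_2)
    ultimately show "((\<lambda>s. dsol T i s $ j) \<longlongrightarrow> dsol T i t $ j) (at t within X)"
      using comp by (auto simp: continuous_on_def)
  qed
qed

lemma blk_A0_domain: "blk i v \<in> A0_domain lam"
  unfolding A0_domain_eq
  by (rule diag_domI [where y = "lam i *\<^sub>R blk i v"])
    (simp add: block_scaleR blk.rep_eq norm_mult abs_eig)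

text \<open>On one block the graph norm is a multiple of the Euclidean norm, so differentiability
  into W reduces to differentiability in \<complex>^2.\<close>

lemma graph_norm_blk: "graph_norm (A0 lam) (blk i v) = sqrt (1 + (lam i)\<^sup>2) * norm v"
proof -
  have "(norm (A0 lam (blk i v)))\<^sup>2 = (norm (lam i *\<^sub>R blk i v))\<^sup>2"
    unfolding norm_hsum_power2 norm_vec2_power2
    by (rule arg_cong [where f = suminf])
      (use blk_A0_domain [of i v] in \<open>auto simp: fun_eq_iff A0_eq A0_domain_eq block_diag block_scaleR
        blk.rep_eq norm_mult\<close>)
  then have "(norm (blk i v))\<^sup>2 + (norm (A0 lam (blk i v)))\<^sup>2 = (1 + (lam i)\<^sup>2) * (norm v)\<^sup>2"
    by (simp add: norm_blk power_mult_distrib algebra_simps)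
  then show ?thesis
    by (simp add: graph_norm_def real_sqrt_mult)
qed

lemma fam_sol: "blk i (dsol T i t) - \<i> *\<^sub>C fam lam T t (blk i (sol T i t)) = 0"
proof (rule hsum_eqI)
  fix k and j :: 2
  \<comment> \<open>The resonance: the coupling phase turns the free phase of one component into
    that of the other.\<close>
  have cis: "cis (t * lam i) * cis (- (t * (lam i * 2))) = cis (- (t * lam i))"
    "cis (- (t * lam i)) * cis (t * (lam i * 2)) = cis (t * lam i)"
    by (simp_all add: cis_mult algebra_simps)
  have "j = 1 \<or> j = 2"
    by (rule exhaust_2)
  then show "block (blk i (dsol T i t) - \<i> *\<^sub>C fam lam T t (blk i (sol T i t))) k $ j = block 0 k $ j"
    by (cases "k = i") (auto simp: block_simps block_fam blk_A0_domain blk.rep_eq sol_def dsol_def cis algebra_simps)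
qed

lemma bounded_linear_blk: "bounded_linear (blk i)"
  by (rule bounded_linear_intro [where K = 1]) (simp_all add: blk_linear norm_blk)

lemma C1_sol:
  assumes "0 < T"
  shows "C1_with_deriv T (A0_domain lam) (graph_norm (A0 lam)) (\<lambda>t. blk i (sol T i t)) (\<lambda>t. blk i (dsol T i t))"
  unfolding C1_with_deriv_def
proof (intro ballI conjI blk_A0_domain)
  fix t assume t: "t \<in> {0..T}"
  have "((\<lambda>s. sqrt (1 + (lam i)\<^sup>2) * norm ((sol T i s - sol T i t) /\<^sub>R (s - t) - dsol T i t)) \<longlongrightarrow> 0)
      (at t within {0..T})"
    using has_vector_derivative_sol [OF assms] unfolding has_vector_derivative_iff_quotient
    by (intro tendsto_mult_right_zero tendsto_norm_zero LIM_zero)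
  then show "((\<lambda>s. graph_norm (A0 lam) ((blk i (sol T i s) - blk i (sol T i t)) /\<^sub>R (s - t) - blk i (dsol T i t)))
      \<longlongrightarrow> 0) (at t within {0..T})"
    by (simp add: graph_norm_blk flip: blk_linear)
  have "((\<lambda>s. sqrt (1 + (lam i)\<^sup>2) * norm (dsol T i s - dsol T i t)) \<longlongrightarrow> 0) (at t within {0..T})"
    using continuous_on_dsol [OF assms] t unfolding continuous_on_def
    by (intro tendsto_mult_right_zero tendsto_norm_zero LIM_zero) blast
  then show "((\<lambda>s. graph_norm (A0 lam) (blk i (dsol T i s) - blk i (dsol T i t))) \<longlongrightarrow> 0) (at t within {0..T})"
    by (simp add: graph_norm_blk flip: blk_linear)
qed

lemma null_functions_zero: "(\<lambda>t. 0) \<in> null_functions T"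
  by (simp add: null_functions_def L2_functions_def L2_norm_sq_def)

lemma sol_in_D_APS_graph:
  assumes "0 < T"
  shows "((\<lambda>t. blk i (sol T i t)), (\<lambda>t. 0)) \<in> D_APS_graph T (A0_domain lam) (fam lam T)"
proof -
  let ?f = "\<lambda>t. blk i (sol T i t)"
  have cont: "continuous_on X ?f" for X
    using bounded_linear.has_vector_derivative [OF bounded_linear_blk has_vector_derivative_sol [OF assms]]
    by (rule continuous_on_vector_derivative)
  have "?f \<in> borel_measurable lborel"
    using borel_measurable_continuous_onI [OF cont] by simp
  then have "?f \<in> borel_measurable (lebesgue_on {0..T})"
    by (intro measurable_restrict_space1 measurable_completion)
  then have L2: "?f \<in> L2_functions T"
    by (simp add: L2_functions_def L2_norm_sq_def norm_blk norm_sol emeasure_restrict_space emeasure_lborel_Icc_eq)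
  have "(?f, \<lambda>t. 0) \<in> D_smooth_graph T (A0_domain lam) (fam lam T)"
    unfolding D_smooth_graph_def fam_ends mem_Collect_eq
    by (intro exI [of _ ?f] exI [of _ "\<lambda>t. blk i (dsol T i t)"] conjI C1_sol [OF assms])
      (simp only: fam_sol)
  \<comment> \<open>The pair is itself smooth and serves as its own approximation, at distance
    0.\<close>
  then have "\<exists>(f0, g0) \<in> D_smooth_graph T (A0_domain lam) (fam lam T).
      L2_norm_sq T (?f - f0) < e \<and> L2_norm_sq T ((\<lambda>t. 0) - g0) < e" if "0 < e" for e
    by (rule bexI [rotated]) (simp add: L2_norm_sq_def that)
  then have D: "(?f, \<lambda>t. 0) \<in> D_graph T (A0_domain lam) (fam lam T)"
    using L2 null_functions_zero [of T] by (simp add: D_graph_def null_functions_def)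
  \<comment> \<open>At time 0 the angle is 0, so the component with eigenvalue \<open>lam i\<close>
    vanishes.\<close>
  have "?f 0 = diag_pvm (eig lam) {..<0} (?f 0)"
  proof (rule hsum_eqI)
    fix k and j :: 2
    show "block (?f 0) k $ j = block (diag_pvm (eig lam) {..<0} (?f 0)) k $ j"
      using exhaust_2 [of j] pos [of k]
      by (auto simp: block_diag_pvm blk.rep_eq sol_def angle_def)
  qed
  then have f0: "?f 0 \<in> range (diag_pvm (eig lam) {..<0})"
    by (rule range_eqI)
  \<comment> \<open>At time \<open>T\<close> the angle is \<open>pi / 2\<close>, so the component
    with eigenvalue \<open>- lam i\<close> vanishes.\<close>
  have "?f T = diag_pvm (eig lam) {0..} (?f T)"
  proof (rule hsum_eqI)
    fix k and j :: 2
    show "block (?f T) k $ j = block (diag_pvm (eig lam) {0..} (?f T)) k $ j"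
      using exhaust_2 [of j] pos [of k] assms
      by (auto simp: block_diag_pvm blk.rep_eq sol_def angle_def)
  qed
  then have fT: "?f T \<in> range (diag_pvm (eig lam) {0..})"
    by (rule range_eqI)
  have "\<exists>h. continuous_on {0..T} h \<and> (AE t in lebesgue_on {0..T}. ?f t = h t) \<and>
      h 0 \<in> range (diag_pvm (eig lam) {..<0}) \<and> h T \<in> range (diag_pvm (eig lam) {0..})"
    using cont f0 fT by (intro exI [of _ ?f] conjI AE_I2 refl)
  then show ?thesis
    using D by (simp add: D_APS_graph_def fam_ends spectral_projection_A0)
qed

text \<open>The kernel contains the solutions supported on the single blocks. Modulo null functions,
  finitely many functions cannot span them: at almost every time the values of the solutions are
  infinitely many orthogonal unit vectors.\<close>

lemma D_APS_not_fredholm: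
  assumes "0 < T"
  shows "\<not> D_APS_fredholm T (A0_domain lam) (fam lam T)"
proof
  let ?f = "\<lambda>i t. blk i (sol T i t)"
  let ?M = "lebesgue_on {0..T}"
  assume "D_APS_fredholm T (A0_domain lam) (fam lam T)"
  then obtain S where S: "finite S"
    and span: "\<And>v u. v \<in> null_functions T \<Longrightarrow> (u, v) \<in> D_APS_graph T (A0_domain lam) (fam lam T) \<Longrightarrow>
      \<exists>c. u - (\<Sum>s\<in>S. (\<lambda>t. c s *\<^sub>C s t)) \<in> null_functions T"
    unfolding D_APS_fredholm_def fredholm_def finite_dim_quotient_def by blast
  have "\<exists>c. ?f i - (\<Sum>s\<in>S. (\<lambda>t. c s *\<^sub>C s t)) \<in> null_functions T" for i
    by (rule span [OF null_functions_zero sol_in_D_APS_graph [OF assms]])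
  then have "\<exists>c. \<forall>i. ?f i - (\<Sum>s\<in>S. (\<lambda>t. c i s *\<^sub>C s t)) \<in> null_functions T"
    by (intro choice allI)
  then obtain c where c: "\<And>i. ?f i - (\<Sum>s\<in>S. (\<lambda>t. c i s *\<^sub>C s t)) \<in> null_functions T"
    by blast
  have sum: "(\<Sum>s\<in>S. (\<lambda>t. c i s *\<^sub>C s t)) t = (\<Sum>s\<in>S. c i s *\<^sub>C s t)" for i t
    using S by (induction S rule: finite_induct) simp_all
  \<comment> \<open>There are countably many blocks, so one null set serves all of them. As [0, T]
    has positive measure, a common good time exists.\<close>
  have AE: "AE t in ?M. \<forall>i. ?f i t - (\<Sum>s\<in>S. c i s *\<^sub>C s t) = 0"
    using c unfolding AE_all_countable by (simp add: null_functions_def sum)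
  have "ae_filter ?M \<noteq> bot"
    using assms by (simp add: ae_filter_eq_bot_iff emeasure_restrict_space)
  then have "\<exists>t. \<forall>i. ?f i t - (\<Sum>s\<in>S. c i s *\<^sub>C s t) = 0"
    using AE by (rule eventually_happens')
  then obtain t where t: "\<And>i. ?f i t = (\<Sum>s\<in>S. c i s *\<^sub>C s t)"
    by auto
  \<comment> \<open>Adding the multiples by \<open>\<i>\<close> turns complex combinations into real
    ones, so that the dimension bound for real spans applies.\<close>
  define V where "V = (\<lambda>s. s t) ` S \<union> (\<lambda>s. \<i> *\<^sub>C s t) ` S"
  have "c i s *\<^sub>C s t \<in> span V" if "s \<in> S" for i s
    unfolding scaleC_eq_scaleR [of "c i s"]
    by (intro span_add span_scale span_base) (use that in \<open>auto simp: V_def\<close>)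
  then have in_span: "range (\<lambda>i. ?f i t) \<subseteq> span V"
    unfolding t by (auto intro: span_sum)
  have orth: "inner (?f i t) (?f k t) = (if i = k then 1 else 0)" for i k
    by (simp add: inner_blk blk.rep_eq norm_sol flip: power2_norm_eq_inner)
  then have "inj (\<lambda>i. ?f i t)"
  proof (intro injI)
    fix k l assume "?f k t = ?f l t"
    then show "k = l"
      using orth [of k l] orth [of k k] by (simp split: if_splits)
  qed
  then have "infinite (range (\<lambda>i. ?f i t))"
    by (rule range_inj_infinite)
  moreover have "finite V"
    using S by (simp add: V_def)
  moreover have "independent (range (\<lambda>i. ?f i t))"
  proof (rule pairwise_orthogonal_independent)
    show "pairwise orthogonal (range (\<lambda>i. ?f i t))"
      by (auto simp: pairwise_def orthogonal_def orth)
    show "0 \<notin> range (\<lambda>i. ?f i t)"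
    proof
      assume "0 \<in> range (\<lambda>i. ?f i t)"
      then obtain i where "?f i t = 0"
        by auto
      then show False
        using orth [of i i] by simp
    qed
  qed
  ultimately show False
    using independent_span_bound [OF _ _ in_span] by blast
qed

end

section \<open>Uniform boundedness of the perturbation and conclusion\<close>

theorem theorem6p2:
  fixes T :: real and lam :: "nat \<Rightarrow> real"
  assumes "0 < T"
    and "\<forall>i. 0 < lam i" and "incseq lam" and "\<not> bdd_above (range lam)"
  shows "\<exists>B :: real \<Rightarrow> hsum \<Rightarrow> hsum.
    (\<forall>t\<in>{0..T}. bounded_op (B t)) \<and> (\<exists>C. \<forall>t\<in>{0..T}. onorm (B t) \<le> C) \<and>
    admissible_family T (A0_domain lam) (\<lambda>t x. A0 lam x + B t x) \<and>
    \<not> D_APS_fredholm T (A0_domain lam) (\<lambda>t x. A0 lam x + B t x)"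
proof (intro exI [of _ "pert lam T"] conjI)
  have fam: "(\<lambda>t x. A0 lam x + pert lam T t x) = fam lam T"
    by (simp add: fun_eq_iff fam_def)
  show "\<forall>t\<in>{0..T}. bounded_op (pert lam T t)"
    unfolding bounded_op_on_def using clinear_on_pert norm_pert_le by blast
  \<comment> \<open>The bound is the amplitude of \<open>angle_rate\<close>, since
    \<open>rot\<close> does not increase norms; it depends neither on t nor on
    \<open>lam\<close>.\<close>
  have "onorm (pert lam T t) \<le> pi\<^sup>2 / (4 * T)" for t
  proof (rule onorm_bound)
    show "norm (pert lam T t x) \<le> pi\<^sup>2 / (4 * T) * norm x" for x
      by (rule order_trans [OF norm_pert_le mult_right_mono [OF abs_angle_rate_le]])
        (simp_all add: assms)
  qed (use assms in simp)
  then show "\<exists>C. \<forall>t\<in>{0..T}. onorm (pert lam T t) \<le> C"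
    by blast
  show "admissible_family T (A0_domain lam) (\<lambda>t x. A0 lam x + pert lam T t x)"
    unfolding fam using assms by (intro admissible_fam) auto
  show "\<not> D_APS_fredholm T (A0_domain lam) (\<lambda>t x. A0 lam x + pert lam T t x)"
    unfolding fam using assms by (intro D_APS_not_fredholm) auto
qed

end
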